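(* Let $m\ge 1$ and let $r,p,q$ be non-negative integers with $p\le q$ and $r+2q\le m$. Let $k\ge 1$ be an integer, and let $\Phi$ denote the restriction of the de Rham differential $d$ to the space $MT^{(r,p,q)}_k$. Then $$\operatorname{Ker}\Phi=\bigoplus_{j=p}^{q}H^{r+2j}_k\qquad\text{and}\qquad \operatorname{Im}\Phi=\bigoplus_{j=p}^{q-1}H^{r+2j+1}_{k-1}.$$ Moreover, $MT^{(r,p,q)}_k\simeq \operatorname{Ker}\Phi\oplus\operatorname{Im}\Phi$ (as $O(m)$-modules, in particular as real vector spaces).
   Context: For $k\ge 0$, $\mathcal P_k$ is the space of real-valued polynomials on $\mathbf R^m$ homogeneous of degree $k$. For $0\le s\le m$, $\mathcal P^s_k=\mathcal P_k\otimes_{\mathbf R}\Lambda^s(\mathbf R^m)$ is the space of differential $s$-forms on $\mathbf R^m$ whose coefficients are in $\mathcal P_k$. The operator $d$ is the de Rham differential and $d^*$ its formal adjoint (the codifferential) with respect to the Euclidean metric, so $d:\mathcal P^s_k\to\mathcal P^{s+1}_{k-1}$ and $d^*:\mathcal P^s_k\to\mathcal P^{s-1}_{k-1}$. Put $$\mathcal P^{(r,p,q)}_k=\bigoplus_{j=p}^q\mathcal P^{r+2j}_k,\qquad MT^{(r,p,q)}_k=\{P\in\mathcal P^{(r,p,q)}_k:\ (d+d^* )P=0\},$$ (homogeneous polynomial solutions of the generalized Moisil-Théodoresco system of type $(r,p,q)$), and $$H^s_k=\{P\in\mathcal P^s_k:\ dP=0,\ d^*P=0\}$$ (homogeneous polynomial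 solutions of the Hodge-de Rham system). The group $O(m)$ acts on polynomial differential forms in the natural way, and $d$, $d^*$ commute with this action. An empty direct sum is $\{0\}$. *)

theory Defs
  imports "HOL-Analysis.Analysis" "HOL-Library.Function_Algebras"
begin

instantiation "fun" :: (type, scaleR) scaleR
begin
definition scaleR_fun :: "real \<Rightarrow> ('a \<Rightarrow> 'b) \<Rightarrow> 'a \<Rightarrow> 'b"
  where "scaleR_fun c f = (\<lambda>x. c *\<^sub>R f x)"
instance ..
end

instance "fun" :: (type, real_vector) real_vector
  by standard (auto simp: scaleR_fun_def plus_fun_def scaleR_add_right scaleR_add_left)

text \<open>A (possibly inhomogeneous) element of the exterior algebra of \<open>R^m\<close> is encoded as a
  function on lists of vectors: its component of degree \<open>s\<close> is the restriction to lists of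
  length \<open>s\<close>, an alternating multilinear form in \<open>s\<close> arguments. The vector space of such
  functions contains the exterior powers for all \<open>s\<close>, in direct sum.\<close>

definition alternating_forms :: "nat \<Rightarrow> ((real^'m) list \<Rightarrow> real) set" where
  "alternating_forms s = {f.
     (\<forall>vs. length vs \<noteq> s \<longrightarrow> f vs = 0) \<and>
     (\<forall>us ws. linear (\<lambda>v. f (us @ v # ws))) \<and>
     (\<forall>us v ws zs. f (us @ v # ws @ v # zs) = 0)}"

type_synonym 'm dform = "real^'m \<Rightarrow> (real^'m) list \<Rightarrow> real"

definition hom_polys :: "nat \<Rightarrow> (real^'m \<Rightarrow> real) set" where
  "hom_polys k = {f. real_polynomial_function f \<and> (\<forall>c x. f (c *\<^sub>R x) = c ^ k * f x)}"

text \<open>The coefficients of \<open>\<omega>\<close> are the functions \<open>\<lambda>x. \<omega> x vs\<close> with \<open>vs\<close> consisting of basis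
  vectors; by multilinearity these lie in \<^const>\<open>hom_polys\<close> iff this holds for all \<open>vs\<close>.\<close>

definition poly_forms :: "nat \<Rightarrow> nat \<Rightarrow> 'm::finite dform set" where
  "poly_forms s k = {\<omega>. (\<forall>x. \<omega> x \<in> alternating_forms s) \<and> (\<forall>vs. (\<lambda>x. \<omega> x vs) \<in> hom_polys k)}"

text \<open>\<open>(d\<omega>)\<^sub>x(v\<^sub>0,\<dots>,v\<^sub>s) = \<Sum>\<^sub>i (-1)^i D\<^sub>v\<^sub>i \<omega>\<^sub>x(v\<^sub>0,\<dots>,omit v\<^sub>i,\<dots>,v\<^sub>s)\<close>,
  i.e. \<open>d = \<Sum>\<^sub>b e\<^sub>b \<and> \<partial>\<^sub>b\<close>.\<close>

definition ext_deriv :: "'m::finite dform \<Rightarrow> 'm dform" where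
  "ext_deriv \<omega> = (\<lambda>x vs. \<Sum>i<length vs.
     (-1) ^ i * frechet_derivative (\<lambda>y. \<omega> y (take i vs @ drop (Suc i) vs)) (at x) (vs ! i))"

text \<open>The formal adjoint of \<^const>\<open>ext_deriv\<close>: the adjoint of \<open>e\<^sub>b \<and>\<close> is insertion of \<open>b\<close> as
  first argument, and that of \<open>\<partial>\<^sub>b\<close> is \<open>-\<partial>\<^sub>b\<close>. See \<open>codiff_formal_adjoint\<close> below.\<close>

definition codiff :: "'m::finite dform \<Rightarrow> 'm dform" where
  "codiff \<omega> = (\<lambda>x vs. - (\<Sum>b\<in>Basis. frechet_derivative (\<lambda>y. \<omega> y (b # vs)) (at x) b))"

definition sum_of_spaces :: "'i set \<Rightarrow> ('i \<Rightarrow> 'a::real_vector set) \<Rightarrow> 'a set" where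
  "sum_of_spaces I V = {\<Sum>i\<in>I. v i | v. \<forall>i\<in>I. v i \<in> V i}"

definition is_direct_sum :: "'a::real_vector set \<Rightarrow> 'i set \<Rightarrow> ('i \<Rightarrow> 'a set) \<Rightarrow> bool" where
  "is_direct_sum W I V \<longleftrightarrow>
     (\<forall>i\<in>I. subspace (V i)) \<and>
     W = sum_of_spaces I V \<and>
     (\<forall>v. (\<forall>i\<in>I. v i \<in> V i) \<and> (\<Sum>i\<in>I. v i) = 0 \<longrightarrow> (\<forall>i\<in>I. v i = 0))"

text \<open>The sum is direct (\<open>poly_forms_rpq_direct\<close> below) because distinct exterior degrees
  live on lists of distinct lengths.\<close>

definition poly_forms_rpq :: "nat \<Rightarrow> nat \<Rightarrow> nat \<Rightarrow> nat \<Rightarrow> 'm::finite dform set" where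
  "poly_forms_rpq r p q k = sum_of_spaces {p..q} (\<lambda>j. poly_forms (r + 2 * j) k)"

definition MT :: "nat \<Rightarrow> nat \<Rightarrow> nat \<Rightarrow> nat \<Rightarrow> 'm::finite dform set" where
  "MT r p q k = {P \<in> poly_forms_rpq r p q k. ext_deriv P + codiff P = 0}"

definition Hodge :: "nat \<Rightarrow> nat \<Rightarrow> 'm::finite dform set" where
  "Hodge s k = {P \<in> poly_forms s k. ext_deriv P = 0 \<and> codiff P = 0}"

text \<open>The natural action is push-forward, i.e. pull-back along the inverse.\<close>

definition form_act :: "(real^'m \<Rightarrow> real^'m) \<Rightarrow> 'm::finite dform \<Rightarrow> 'm dform" where
  "form_act g \<omega> = (\<lambda>x vs. \<omega> (inv g x) (map (inv g) vs))"

definition O_submodule ::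
  "((real^'m::finite \<Rightarrow> real^'m) \<Rightarrow> 'a::real_vector \<Rightarrow> 'a) \<Rightarrow> 'a set \<Rightarrow> bool" where
  "O_submodule \<rho> A \<longleftrightarrow>
     subspace A \<and> (\<forall>g. orthogonal_transformation g \<longrightarrow> (\<forall>a\<in>A. \<rho> g a \<in> A))"

definition O_isomorphic ::
  "((real^'m::finite \<Rightarrow> real^'m) \<Rightarrow> 'a::real_vector \<Rightarrow> 'a) \<Rightarrow> 'a set \<Rightarrow>
   ((real^'m \<Rightarrow> real^'m) \<Rightarrow> 'b::real_vector \<Rightarrow> 'b) \<Rightarrow> 'b set \<Rightarrow> bool" where
  "O_isomorphic \<rho> A \<sigma> B \<longleftrightarrow>
     O_submodule \<rho> A \<and> O_submodule \<sigma> B \<and>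
     (\<exists>T. bij_betw T A B \<and>
        (\<forall>a\<in>A. \<forall>a'\<in>A. T (a + a') = T a + T a') \<and>
        (\<forall>c. \<forall>a\<in>A. T (c *\<^sub>R a) = c *\<^sub>R T a) \<and>
        (\<forall>g. orthogonal_transformation g \<longrightarrow> (\<forall>a\<in>A. T (\<rho> g a) = \<sigma> g (T a))))"

lemma subspace_alternating_forms:
  "subspace (alternating_forms s :: ((real^'m::finite) list \<Rightarrow> real) set)"
  unfolding subspace_def alternating_forms_def
  by (simp add: zero_fun_def plus_fun_def scaleR_fun_def linear_iff algebra_simps)

lemma subspace_hom_polys: "subspace (hom_polys k :: (real^'m::finite \<Rightarrow> real) set)"
proof (rule subspaceI)
  show "c *\<^sub>R f \<in> hom_polys k" if "f \<in> hom_polys k" for c and f :: "real^'m \<Rightarrow> real"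
    using that real_polynomial_function.intros(4)[OF real_polynomial_function.intros(2)[of c], of f]
    by (simp add: hom_polys_def scaleR_fun_def mult_ac)
qed (auto simp: hom_polys_def zero_fun_def plus_fun_def distrib_left)

lemma subspace_poly_forms: "subspace (poly_forms s k :: 'm::finite dform set)"
proof (rule subspaceI)
  show "0 \<in> (poly_forms s k :: 'm dform set)"
  proof -
    have "(0 :: (real^'m) list \<Rightarrow> real) \<in> alternating_forms s"
      and "(0 :: real^'m \<Rightarrow> real) \<in> hom_polys k"
      by (rule subspace_0, rule subspace_alternating_forms subspace_hom_polys)+
    then show ?thesis
      by (simp add: poly_forms_def zero_fun_def)
  qed
  show "\<omega> + \<eta> \<in> poly_forms s k" if "\<omega> \<in> poly_forms s k" "\<eta> \<in> poly_forms s k"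
    for \<omega> \<eta> :: "'m dform"
  proof -
    have "\<omega> x + \<eta> x \<in> alternating_forms s"
      and "(\<lambda>x. \<omega> x vs) + (\<lambda>x. \<eta> x vs) \<in> hom_polys k" for x vs
      using that by (auto simp: poly_forms_def
          intro: subspace_add[OF subspace_alternating_forms] subspace_add[OF subspace_hom_polys])
    then show ?thesis
      by (simp add: poly_forms_def plus_fun_def)
  qed
  show "c *\<^sub>R \<omega> \<in> poly_forms s k" if "\<omega> \<in> poly_forms s k" for c and \<omega> :: "'m dform"
  proof -
    have "c *\<^sub>R \<omega> x \<in> alternating_forms s" and "c *\<^sub>R (\<lambda>x. \<omega> x vs) \<in> hom_polys k" for x vs
      using that by (auto simp: poly_forms_def
          intro: subspace_scale[OF subspace_alternating_forms] subspace_scale[OF subspace_hom_polys])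
    then show ?thesis
      by (simp add: poly_forms_def scaleR_fun_def)
  qed
qed

lemma poly_forms_rpq_direct:
  "is_direct_sum (poly_forms_rpq r p q k :: 'm::finite dform set) {p..q}
     (\<lambda>j. poly_forms (r + 2 * j) k)"
proof -
  have "v i = 0"
    if v: "\<And>j. j \<in> {p..q} \<Longrightarrow> v j \<in> poly_forms (r + 2 * j) k"
      and 0: "(\<Sum>j=p..q. v j) = 0" and i: "i \<in> {p..q}"
    for v :: "nat \<Rightarrow> 'm dform" and i
  proof (intro ext)
    fix x vs
    have z: "v j x vs = 0" if "j \<in> {p..q}" "length vs \<noteq> r + 2 * j" for j
      using v[OF that(1)] that(2) by (auto simp: poly_forms_def alternating_forms_def)
    have app: "(\<Sum>j\<in>A. v j) x vs = (\<Sum>j\<in>A. v j x vs)" for A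
      by (induction A rule: infinite_finite_induct) simp_all
    show "v i x vs = (0 :: 'm dform) x vs"
    proof (cases "length vs = r + 2 * i")
      case True
      then have "(\<Sum>j\<in>{p..q} - {i}. v j x vs) = 0"
        by (intro sum.neutral ballI z) auto
      then have "v i x vs = (\<Sum>j=p..q. v j x vs)"
        using i by (subst sum.remove[of _ i]) simp_all
      also have "\<dots> = 0"
        using app[of "{p..q}"] unfolding 0 by simp
      finally show ?thesis by simp
    qed (simp add: z[OF i])
  qed
  then show ?thesis
    unfolding is_direct_sum_def poly_forms_rpq_def
    by (intro conjI ballI allI impI subspace_poly_forms refl) blast
qed

text \<open>The inner product of \<open>s\<close>-forms for which the products \<open>e\<^sub>I\<close> of distinct orthonormal
  basis vectors are orthonormal, summed over all index tuples, so that
  each \<open>I\<close> occurs \<open>s!\<close> times.\<close>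

definition form_inner ::
  "nat \<Rightarrow> ((real^'m::finite) list \<Rightarrow> real) \<Rightarrow> ((real^'m) list \<Rightarrow> real) \<Rightarrow> real" where
  "form_inner s f g = (\<Sum>vs | set vs \<subseteq> Basis \<and> length vs = s. f vs * g vs) / fact s"

lemma alternating_swap:
  assumes f: "f \<in> alternating_forms s"
  shows "f (us @ a # b # ws) = - f (us @ b # a # ws)"
proof -
  have lin: "linear (\<lambda>v. f (xs @ v # ys))" for xs ys
    using f unfolding alternating_forms_def by blast
  have alt: "f (xs @ v # v # ys) = 0" for xs v ys
  proof -
    have "f (xs @ v # [] @ v # ys) = 0"
      using f unfolding alternating_forms_def by blast
    then show ?thesis by simp
  qed
  have l1: "f (us @ (a + b) # c # ws) = f (us @ a # c # ws) + f (us @ b # c # ws)" for c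
    using linear_add[OF lin[of us "c # ws"], of a b] .
  have l2: "f (us @ c # (a + b) # ws) = f (us @ c # a # ws) + f (us @ c # b # ws)" for c
    using linear_add[OF lin[of "us @ [c]" ws], of a b] by simp
  show ?thesis
    using alt[of us "a + b" ws] alt[of us a ws] alt[of us b ws] unfolding l1 l2 by linarith
qed

lemma alternating_to_front:
  assumes f: "f \<in> alternating_forms s"
  shows "f (us @ a # ws) = (-1) ^ length us * f (a # us @ ws)"
proof (induction us arbitrary: ws rule: rev_induct)
  case (snoc u us)
  have "f ((us @ [u]) @ a # ws) = - f (us @ a # u # ws)"
    using alternating_swap[OF f, of us u a ws] by simp
  then show ?case
    using snoc[of "u # ws"] by simp
qed simp

text \<open>Formal adjointness: the two pairings differ by the divergence of the vector field
  with components \<open>\<langle>e\<^sub>b \<and> \<alpha>, \<beta>\<rangle>\<close>.\<close>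

lemma codiff_formal_adjoint:
  fixes \<alpha> \<beta> :: "'m::finite dform"
  assumes \<alpha>: "\<And>vs. (\<lambda>y. \<alpha> y vs) differentiable at x"
    and \<beta>: "\<And>vs. (\<lambda>y. \<beta> y vs) differentiable at x"
    and alt: "\<beta> x \<in> alternating_forms (Suc s)"
  shows "form_inner (Suc s) (ext_deriv \<alpha> x) (\<beta> x) - form_inner s (\<alpha> x) (codiff \<beta> x) =
    (\<Sum>b\<in>Basis. frechet_derivative (\<lambda>y. form_inner s (\<alpha> y) (\<lambda>vs. \<beta> y (b # vs))) (at x) b)"
proof -
  let ?S = "\<lambda>s. {vs :: (real^'m) list. set vs \<subseteq> Basis \<and> length vs = s}"
  have fin: "finite (?S n)" for n by (rule finite_lists_length_eq) simp
  define A where "A b vs = frechet_derivative (\<lambda>y. \<alpha> y vs) (at x) b" for b vs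
  define B where "B b vs = frechet_derivative (\<lambda>y. \<beta> y vs) (at x) b" for b vs
  define G where "G = (\<Sum>(b, ws) \<in> Basis \<times> ?S s. A b ws * \<beta> x (b # ws))"
  have one: "(\<Sum>vs\<in>?S (Suc s). (-1) ^ i * A (vs ! i) (take i vs @ drop (Suc i) vs) * \<beta> x vs) = G"
    if i: "i \<le> s" for i
    unfolding G_def
  proof (rule sum.reindex_bij_witness[where
        i = "\<lambda>(b, ws). take i ws @ b # drop i ws" and
        j = "\<lambda>vs. (vs ! i, take i vs @ drop (Suc i) vs)"], goal_cases)
    case (1 vs)
    then show ?case using i by (simp add: id_take_nth_drop[symmetric])
  next
    case (2 vs)
    then show ?case using i by (auto dest: in_set_takeD in_set_dropD)
  next
    case (3 bws)
    then show ?case using i by (auto simp: nth_append min_def)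
  next
    case (4 bws)
    then show ?case using i by (auto dest: in_set_takeD in_set_dropD)
  next
    case (5 vs)
    then have "\<beta> x vs = (-1) ^ i * \<beta> x (vs ! i # take i vs @ drop (Suc i) vs)"
      using i alternating_to_front[OF alt, of "take i vs" "vs ! i" "drop (Suc i) vs"]
      by (simp add: id_take_nth_drop[symmetric] min_def)
    moreover have "(-1::real) ^ i * (-1) ^ i = 1"
      by (simp flip: power_mult_distrib)
    ultimately show ?case
      by (simp add: mult_ac)
  qed
  have "(\<Sum>vs\<in>?S (Suc s). ext_deriv \<alpha> x vs * \<beta> x vs) =
      (\<Sum>vs\<in>?S (Suc s). \<Sum>i<Suc s. (-1) ^ i * A (vs ! i) (take i vs @ drop (Suc i) vs) * \<beta> x vs)"
    by (intro sum.cong) (auto simp: ext_deriv_def A_def sum_distrib_right simp del: sum.lessThan_Suc)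
  also have "\<dots> = (\<Sum>i<Suc s. G)"
    by (subst sum.swap, intro sum.cong refl one) auto
  finally have L: "form_inner (Suc s) (ext_deriv \<alpha> x) (\<beta> x) = G / fact s"
    by (simp add: form_inner_def divide_simps del: of_nat_Suc)
  have R: "form_inner s (\<alpha> x) (codiff \<beta> x) =
      - (\<Sum>b\<in>Basis. \<Sum>ws\<in>?S s. \<alpha> x ws * B b (b # ws)) / fact s"
    unfolding form_inner_def codiff_def B_def
    by (subst sum.swap) (simp add: sum_distrib_left sum_negf)
  have der: "frechet_derivative (\<lambda>y. form_inner s (\<alpha> y) (\<lambda>vs. \<beta> y (b # vs))) (at x) b =
      (\<Sum>ws\<in>?S s. A b ws * \<beta> x (b # ws) + \<alpha> x ws * B b (b # ws)) / fact s" for b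
  proof -
    have "((\<lambda>y. form_inner s (\<alpha> y) (\<lambda>vs. \<beta> y (b # vs))) has_derivative
      (\<lambda>h. (\<Sum>ws\<in>?S s. \<alpha> x ws * B h (b # ws) + A h ws * \<beta> x (b # ws)) / fact s)) (at x)"
      unfolding form_inner_def A_def B_def divide_inverse
      by (intro has_derivative_mult_left has_derivative_sum has_derivative_mult
          \<alpha>[unfolded frechet_derivative_works] \<beta>[unfolded frechet_derivative_works])
    from frechet_derivative_at[OF this, symmetric] show ?thesis
      by (simp add: add.commute)
  qed
  have G: "G = (\<Sum>b\<in>Basis. \<Sum>ws\<in>?S s. A b ws * \<beta> x (b # ws))"
    unfolding G_def by (rule sum.cartesian_product[symmetric])
  have "(\<Sum>b\<in>Basis. (\<Sum>ws\<in>?S s. A b ws * \<beta> x (b # ws) + \<alpha> x ws * B b (b # ws)) / fact s) =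
      (G + (\<Sum>b\<in>Basis. \<Sum>ws\<in>?S s. \<alpha> x ws * B b (b # ws))) / fact s"
    unfolding G by (simp only: sum.distrib sum_divide_distrib[symmetric])
  then show ?thesis
    unfolding L R der by (simp add: add_divide_distrib)
qed

end

theory Submission
  imports Defs
begin

text \<open>Let \<open>x\<close> denote both the position vector and the dual 1-form. On a form \<open>h\<close> of degree \<open>s\<close>
  with coefficients of degree \<open>k - 1\<close> that is closed and coclosed, Cartan's formula
  gives \<open>d (\<iota>\<^sub>x h) = (k - 1 + s) h\<close> and, dually, \<open>d\<^sup>* (x \<and> h) = - (k - 1 + m - s) h\<close>, while
  \<open>d\<^sup>* (\<iota>\<^sub>x h) = 0\<close> and \<open>d (x \<and> h) = 0\<close>. Both factors are nonzero in the relevant range of \<open>s\<close>, so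
  \<open>S h = (\<iota>\<^sub>x h) / (k - 1 + s) + (x \<and> h) / (k - 1 + m - s)\<close> lies in the kernel of \<open>d + d\<^sup>*\<close> and satisfies
  \<open>d (S h) = h\<close>. Conversely, comparing degrees in \<open>(d + d\<^sup>*) P = 0\<close> shows
  \<open>d P\<^sub>j = - d\<^sup>* P\<^sub>j\<^sub>+\<^sub>1\<close>, which is closed and coclosed. As \<open>S\<close> is linear and \<open>O(m)\<close>-equivariant,
  \<open>P \<mapsto> (P - S (d P), d P)\<close> is the required isomorphism.\<close>

section \<open>Alternation\<close>

text \<open>Exterior multiplication in list form: the vector removed from the list goes to the first
  argument of \<open>A\<close>. Both \<open>ext_deriv\<close> and \<open>wedge\<close> are
  instances. \<open>A\<close> is an arbitrary function, so that inductions may pass to families that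
  are no longer alternating.\<close>

definition alt :: "('a \<Rightarrow> 'a list \<Rightarrow> real) \<Rightarrow> 'a list \<Rightarrow> real" where
  "alt A vs = (\<Sum>i<length vs. (-1) ^ i * A (vs ! i) (take i vs @ drop (Suc i) vs))"

lemma alt_Nil [simp]: "alt A [] = 0"
  by (simp add: alt_def)

text \<open>The summand \<open>i = 0\<close> removes \<open>v\<close>; in all others
  \<open>v\<close> stays at the head of the list and the shift of \<open>i\<close> by one flips the
  sign. This recursion drives the inductions below.\<close>

lemma alt_Cons: "alt A (v # vs) = A v vs - alt (\<lambda>u zs. A u (v # zs)) vs"
  by (simp add: alt_def sum.lessThan_Suc_shift sum_negf del: sum.lessThan_Suc)

lemma alt_add: "alt (\<lambda>u zs. A u zs + B u zs) vs = alt A vs + alt B vs"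
  by (simp add: alt_def sum.distrib distrib_left)

lemma alt_minus: "alt (\<lambda>u zs. - A u zs) vs = - alt A vs"
  by (simp add: alt_def sum_negf)

lemma alt_cmult: "alt (\<lambda>u zs. c * A u zs) vs = c * alt A vs"
  by (simp add: alt_def sum_distrib_left mult_ac)

lemma alt_sum: "alt (\<lambda>u zs. \<Sum>i\<in>I. A i u zs) vs = (\<Sum>i\<in>I. alt (A i) vs)"
proof -
  have "alt (\<lambda>u zs. \<Sum>i\<in>I. A i u zs) vs =
      (\<Sum>n<length vs. \<Sum>i\<in>I. (-1) ^ n * A i (vs ! n) (take n vs @ drop (Suc n) vs))"
    by (simp add: alt_def sum_distrib_left)
  then show ?thesis
    by (subst (asm) sum.swap) (simp add: alt_def)
qed

lemma alt_map: "alt A (map g vs) = alt (\<lambda>u zs. A (g u) (map g zs)) vs"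
  by (simp add: alt_def take_map drop_map)

lemma alt_cong: "(\<And>u zs. A u zs = B u zs) \<Longrightarrow> alt A vs = alt B vs"
  by (simp add: alt_def)

lemma alt_eq_0:
  assumes "\<And>u zs. length vs = Suc (length zs) \<Longrightarrow> A u zs = 0"
  shows "alt A vs = 0"
  unfolding alt_def by (intro sum.neutral ballI) (auto intro!: assms)

text \<open>Peeling \<open>w\<close> off both alternations leaves two simple alternations with
  opposite signs, which the swap of the arguments of \<open>A\<close> interchanges, and a double
  alternation over \<open>vs\<close> covered by the induction hypothesis. This sign is behind both
  \<open>ext_deriv_ext_deriv\<close> and \<open>ext_deriv_wedge\<close>.\<close>

lemma alt_alt_swap: "alt (\<lambda>u. alt (A u)) vs = - alt (\<lambda>u. alt (\<lambda>v. A v u)) vs"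
proof (induction vs arbitrary: A)
  case (Cons w vs)
  have "alt (\<lambda>u. alt (A u)) (w # vs) =
      alt (A w) vs - alt (\<lambda>u. A u w) vs + alt (\<lambda>u. alt (\<lambda>v ys. A u v (w # ys))) vs" for A
    using alt_add[of "\<lambda>u. A u w" "\<lambda>u zs. - alt (\<lambda>v ys. A u v (w # ys)) zs" vs]
    by (simp add: alt_Cons alt_minus)
  from this[of A] this[of "\<lambda>u v. A v u"] Cons[of "\<lambda>u v ys. A u v (w # ys)"]
  show ?case by simp
qed simp

lemma alt_alt_symmetric:
  assumes "\<And>u v zs. A u v zs = A v u zs"
  shows "alt (\<lambda>u. alt (A u)) vs = 0"
proof -
  have "alt (\<lambda>u. alt (A u)) vs = alt (\<lambda>u. alt (\<lambda>v. A v u)) vs"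
    by (rule alt_cong, rule alt_cong, rule assms)
  with alt_alt_swap[of A vs] show ?thesis by linarith
qed

lemma linear_times_compose: "linear f \<Longrightarrow> linear (\<lambda>x. c * f x :: real)"
  using linear_compose_scale_right[of f c] by simp

lemma linear_alt_family:
  assumes "\<And>u zs. linear (\<lambda>v. A v u zs)"
  shows "linear (\<lambda>v. alt (A v) vs)"
  unfolding alt_def
  by (intro linear_compose_sum ballI linear_times_compose assms)

text \<open>In each summand the variable vector is either the one removed or still in the list; the
  two assumptions treat these two cases.\<close>

lemma linear_alt:
  assumes "\<And>zs. linear (\<lambda>u. A u zs)" "\<And>u ys zs. linear (\<lambda>v. A u (ys @ v # zs))"
  shows "linear (\<lambda>v. alt A (us @ v # ws))"
  using assms
proof (induction us arbitrary: A)
  case Nil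
  have "linear (\<lambda>v. A u (v # zs))" for u zs
    using Nil(2)[of u "[]" zs] by simp
  then have "linear (\<lambda>v. alt (\<lambda>u zs. A u (v # zs)) ws)"
    by (rule linear_alt_family)
  then show ?case
    unfolding append_Nil alt_Cons by (rule linear_compose_sub[OF Nil(1)])
next
  case (Cons u us)
  have "linear (\<lambda>v. A w (u # ys @ v # zs))" for w ys zs
    using Cons.prems(2)[of w "u # ys" zs] by simp
  with Cons.prems(1) have "linear (\<lambda>v. alt (\<lambda>w zs. A w (u # zs)) (us @ v # ws))"
    by (rule Cons.IH)
  then show ?case
    unfolding append_Cons alt_Cons by (rule linear_compose_sub[OF Cons.prems(2)])
qed

text \<open>If \<open>A\<close> vanishes whenever \<open>v\<close> is left in the list, only the
  summand that removes the displayed \<open>v\<close> survives.\<close>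

lemma alt_single:
  assumes "\<And>u ys zs. A u (ys @ v # zs) = 0"
  shows "alt A (ws @ v # zs) = (-1) ^ length ws * A v (ws @ zs)"
  using assms
proof (induction ws arbitrary: A)
  case Nil
  have "A u (v # xs) = 0" for u xs
    using Nil[of u "[]" xs] by simp
  then have "alt (\<lambda>u xs. A u (v # xs)) zs = 0"
    by (intro alt_eq_0)
  then show ?case
    by (simp add: alt_Cons)
next
  case (Cons w ws)
  have "A u (w # ys @ v # zs) = 0" for u ys zs
    using Cons.prems[of u "w # ys" zs] by simp
  then have "alt (\<lambda>u zs. A u (w # zs)) (ws @ v # zs) = (-1) ^ length ws * A v (w # ws @ zs)"
    by (rule Cons.IH)
  then show ?case
    using Cons.prems[of w ws zs] by (simp add: alt_Cons)
qed

lemma alternatingD: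
  assumes "f \<in> alternating_forms s"
  shows "length vs \<noteq> s \<Longrightarrow> f vs = 0" "linear (\<lambda>v. f (us @ v # ws))" "f (us @ v # ws @ v # zs) = 0"
  using assms unfolding alternating_forms_def by blast+

lemma alternating_linear_hd:
  assumes "f \<in> alternating_forms s"
  shows "linear (\<lambda>v. f (v # ws))"
  using alternatingD(2)[OF assms, of "[]"] by (simp only: append_Nil)

lemma alternating_repeat_hd:
  assumes "f \<in> alternating_forms s"
  shows "f (v # us @ v # ws) = 0" "f (v # v # ws) = 0"
  using alternatingD(3)[OF assms, of "[]"] alternatingD(3)[OF assms, of "[]" v "[]"] by simp_all

lemma alternating_swap_hd:
  assumes "f \<in> alternating_forms s"
  shows "f (a # b # ws) = - f (b # a # ws)"
  by (rule alternating_swap[OF assms, of "[]", unfolded append_Nil])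

text \<open>The point is vanishing on a repeated vector: only the two summands that remove one of
  its copies survive, and they cancel by sign.\<close>

lemma alt_in_alternating_forms:
  fixes A :: "real^'m::finite \<Rightarrow> (real^'m) list \<Rightarrow> real"
  assumes A: "\<And>u. A u \<in> alternating_forms s" and lin: "\<And>zs. linear (\<lambda>u. A u zs)"
  shows "alt A \<in> alternating_forms (Suc s)"
proof -
  \<comment> \<open>Stated for any \<open>B\<close> with the two properties used, because they
    persist when a vector is fixed at the head of the list, whereas membership in
    \<open>alternating_forms s\<close> does not.\<close>
  have alt_B: "alt B (us @ v # ws @ v # zs) = 0"
    if "\<And>w us' v ws zs. B w (us' @ v # ws @ v # zs) = 0"
      "\<And>w us' v ws zs. B w (us' @ v # ws @ zs) = (-1) ^ length ws * B w (us' @ ws @ v # zs)"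
    for B :: "real^'m \<Rightarrow> (real^'m) list \<Rightarrow> real" and us v ws zs
    using that
  proof (induction us arbitrary: B)
    case Nil
    have "B u (v # ys @ v # zs) = 0" for u ys zs
      using Nil(1)[of u "[]" v ys zs] by simp
    then have "alt (\<lambda>u xs. B u (v # xs)) (ws @ v # zs) = (-1) ^ length ws * B v (v # ws @ zs)"
      by (rule alt_single)
    also have "\<dots> = B v (ws @ v # zs)"
      using Nil(2)[of v "[]" v ws zs] by simp
    finally show ?case by (simp add: alt_Cons)
  next
    case (Cons u us)
    have "B w (u # us' @ v # ws @ v # zs) = 0"
      and "B w (u # us' @ v # ws @ zs) = (-1) ^ length ws * B w (u # us' @ ws @ v # zs)"
      for w us' v ws zs
      using Cons.prems(1)[of w "u # us'" v ws zs] Cons.prems(2)[of w "u # us'" v ws zs] by simp_all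
    then have "alt (\<lambda>w xs. B w (u # xs)) (us @ v # ws @ v # zs) = 0"
      by (rule Cons.IH)
    then show ?case using Cons.prems(1) by (simp add: alt_Cons)
  qed
  have move: "A w (us @ v # ws @ zs) = (-1) ^ length ws * A w (us @ ws @ v # zs)" for w us v ws zs
    using alternating_to_front[OF A[of w], of us v "ws @ zs"]
      alternating_to_front[OF A[of w], of "us @ ws" v zs]
    by (simp add: power_add)
  have "alt A (us @ v # ws @ v # zs) = 0" for us v ws zs
    by (rule alt_B[OF alternatingD(3)[OF A] move])
  moreover have "linear (\<lambda>v. alt A (us @ v # ws))" for us ws
    by (rule linear_alt) (rule lin, rule alternatingD(2)[OF A])
  moreover have "alt A vs = 0" if "length vs \<noteq> Suc s" for vs
    by (rule alt_eq_0, rule alternatingD(1)[OF A]) (use that in simp)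
  ultimately show ?thesis
    unfolding alternating_forms_def by blast
qed

text \<open>Moving \<open>vs ! i\<close> from the front back to position \<open>i\<close> produces
  exactly the sign \<open>(-1) ^ i\<close>, so all summands equal \<open>f vs\<close>. This is the
  source of the degree \<open>s\<close> in both Cartan formulas.\<close>

lemma alt_alternating:
  assumes "f \<in> alternating_forms s"
  shows "alt (\<lambda>u zs. f (u # zs)) vs = real (length vs) * f vs"
proof -
  have "(-1) ^ i * f (vs ! i # take i vs @ drop (Suc i) vs) = f vs" if "i < length vs" for i
    using that alternating_to_front[OF assms, of "take i vs" "vs ! i" "drop (Suc i) vs"]
    by (simp add: id_take_nth_drop[symmetric] min_def)
  then show ?thesis by (simp add: alt_def)
qed

section \<open>Directional derivatives of polynomials\<close>

abbreviation dd :: "('a::real_normed_vector \<Rightarrow> real) \<Rightarrow> 'a \<Rightarrow> 'a \<Rightarrow> real" where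
  "dd f v x \<equiv> frechet_derivative f (at x) v"

lemma dd_eqI: "(f has_derivative f') (at x) \<Longrightarrow> dd f v x = f' v"
  by (drule frechet_derivative_at) simp

context
  fixes f :: "'a::euclidean_space \<Rightarrow> real"
  assumes f: "real_polynomial_function f"
begin

lemma poly_has_derivative: "(f has_derivative (\<lambda>v. dd f v x)) (at x)"
  using differentiable_at_real_polynomial_function[OF f] by (simp add: frechet_derivative_works)

lemma linear_dd: "linear (\<lambda>v. dd f v x)"
  using poly_has_derivative has_derivative_linear by blast

end

lemma dd_add:
  fixes f g :: "'a::euclidean_space \<Rightarrow> real"
  assumes "real_polynomial_function f" "real_polynomial_function g"
  shows "dd (\<lambda>x. f x + g x) v x = dd f v x + dd g v x"
  by (rule dd_eqI has_derivative_add poly_has_derivative assms)+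

lemma dd_mult:
  fixes f g :: "'a::euclidean_space \<Rightarrow> real"
  assumes "real_polynomial_function f" "real_polynomial_function g"
  shows "dd (\<lambda>x. f x * g x) v x = f x * dd g v x + dd f v x * g x"
  by (rule dd_eqI has_derivative_mult poly_has_derivative assms)+

lemma dd_cmult:
  fixes f :: "'a::euclidean_space \<Rightarrow> real"
  assumes "real_polynomial_function f"
  shows "dd (\<lambda>x. c * f x) v x = c * dd f v x"
  by (rule dd_eqI has_derivative_mult_right poly_has_derivative assms)+

lemma dd_sum:
  fixes f :: "'i \<Rightarrow> 'a::euclidean_space \<Rightarrow> real"
  assumes "\<And>i. i \<in> I \<Longrightarrow> real_polynomial_function (f i)"
  shows "dd (\<lambda>x. \<Sum>i\<in>I. f i x) v x = (\<Sum>i\<in>I. dd (f i) v x)"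
  by (rule dd_eqI has_derivative_sum poly_has_derivative assms)+

lemma dd_linear: "bounded_linear f \<Longrightarrow> dd f v x = f v"
  by (intro dd_eqI bounded_linear_imp_has_derivative)

lemma poly_linear: "linear f \<Longrightarrow> real_polynomial_function f"
  for f :: "'a::euclidean_space \<Rightarrow> real"
  by (simp add: real_polynomial_function.intros(1) linear_conv_bounded_linear)

lemma poly_dd:
  assumes "real_polynomial_function (f :: 'a::euclidean_space \<Rightarrow> real)"
  shows "real_polynomial_function (\<lambda>x. dd f v x)"
  using assms
  by (induction rule: real_polynomial_function.induct)
    (auto simp: dd_add dd_mult dd_linear intro!: real_polynomial_function.intros(2-4))

text \<open>Symmetry of second derivatives by induction on the construction of the polynomial:
  second derivatives of linear functions and constants vanish, and two applications of the product
  rule give an expression symmetric in \<open>u\<close> and \<open>v\<close>.\<close>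

lemma dd_commute:
  assumes "real_polynomial_function (f :: 'a::euclidean_space \<Rightarrow> real)"
  shows "dd (\<lambda>x. dd f u x) v x = dd (\<lambda>x. dd f v x) u x"
  using assms
proof (induction rule: real_polynomial_function.induct)
  case (mult f g)
  then show ?case
    by (simp add: dd_mult dd_add poly_dd real_polynomial_function.intros)
qed (simp_all add: dd_add poly_dd dd_linear)

lemma poly_compose_linear:
  fixes f :: "'a::euclidean_space \<Rightarrow> real" and g :: "'b::euclidean_space \<Rightarrow> 'a"
  assumes "real_polynomial_function f" "linear g"
  shows "real_polynomial_function (\<lambda>x. f (g x))"
  using assms(1)
proof (induction rule: real_polynomial_function.induct)
  case (linear f)
  then show ?case
    using linear_compose[OF assms(2), of f]
    by (intro poly_linear) (simp add: linear_conv_bounded_linear o_def)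
qed (auto intro: real_polynomial_function.intros)

lemma dd_compose_linear:
  fixes f :: "'a::euclidean_space \<Rightarrow> real" and g :: "'b::euclidean_space \<Rightarrow> 'a"
  assumes "real_polynomial_function f" "linear g"
  shows "dd (\<lambda>x. f (g x)) v x = dd f (g v) (g x)"
proof -
  have "(g has_derivative g) (at x)"
    using assms(2) by (simp add: bounded_linear_imp_has_derivative linear_conv_bounded_linear)
  then show ?thesis
    by (intro dd_eqI has_derivative_compose[of g g _ UNIV f "\<lambda>v. dd f v (g x)"] poly_has_derivative assms(1))
qed

lemma hom_polysD:
  assumes "f \<in> hom_polys k"
  shows "real_polynomial_function f" "f (c *\<^sub>R x) = c ^ k * f x"
  using assms by (auto simp: hom_polys_def)

text \<open>The function \<open>f (c x)\<close> of the scalar \<open>c\<close> is differentiated at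
  \<open>c = 1\<close> twice: by the chain rule, and after homogeneity has turned it into
  \<open>c ^ k * f x\<close>.\<close>

lemma euler_identity:
  fixes f :: "real^'m::finite \<Rightarrow> real"
  assumes f: "f \<in> hom_polys k"
  shows "dd f x x = real k * f x"
proof -
  note p = hom_polysD[OF f]
  have "((\<lambda>c::real. f (c *\<^sub>R x)) has_derivative (\<lambda>c. dd f (c *\<^sub>R x) (1 *\<^sub>R x))) (at 1)"
    by (rule has_derivative_compose[of "\<lambda>c. c *\<^sub>R x" _ _ UNIV f])
      (auto intro!: derivative_eq_intros poly_has_derivative p)
  moreover have "((\<lambda>c::real. f (c *\<^sub>R x)) has_derivative (\<lambda>c. c * (real k * f x))) (at 1)"
    unfolding p by (auto intro!: derivative_eq_intros)
  ultimately have "(\<lambda>c. dd f (c *\<^sub>R x) (1 *\<^sub>R x)) = (\<lambda>c. c * (real k * f x))"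
    by (rule has_derivative_unique)
  from fun_cong[OF this, of 1] show ?thesis by simp
qed

text \<open>Differentiating \<open>f (c x) = c ^ k * f x\<close> in \<open>x\<close> gives a factor
  \<open>c\<close> on the left, which can be cancelled for nonzero \<open>c\<close>.\<close>

lemma dd_hom_polys:
  fixes f :: "real^'m::finite \<Rightarrow> real"
  assumes f: "f \<in> hom_polys k" and k: "1 \<le> k"
  shows "(\<lambda>x. dd f v x) \<in> hom_polys (k - 1)"
proof -
  note p = hom_polysD[OF f]
  have *: "dd f v (c *\<^sub>R x) = c ^ (k - 1) * dd f v x" if "c \<noteq> 0" for c x
  proof -
    have "dd (\<lambda>x. f (c *\<^sub>R x)) v x = dd f (c *\<^sub>R v) (c *\<^sub>R x)"
      by (rule dd_compose_linear[OF p(1)]) simp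
    moreover have "dd (\<lambda>x. f (c *\<^sub>R x)) v x = c ^ k * dd f v x"
      unfolding p by (rule dd_cmult[OF p(1)])
    ultimately have "c * dd f v (c *\<^sub>R x) = c ^ k * dd f v x"
      using linear_scale[OF linear_dd[OF p(1)]] by simp
    then show ?thesis using that k by (cases k) simp_all
  qed
  \<comment> \<open>At \<open>c = 0\<close> nothing can be cancelled; the identity is the limit of
    the case of nonzero \<open>c\<close>, both sides being continuous in \<open>c\<close>. For
    \<open>k = 1\<close> the factor \<open>0 ^ (k - 1)\<close> is 1.\<close>
  have "dd f v (0 *\<^sub>R x) = 0 ^ (k - 1) * dd f v x" for x
  proof (rule LIM_unique[of "\<lambda>c::real. dd f v (c *\<^sub>R x)" _ 0])
    have "isCont (\<lambda>x. dd f v x) y" for y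
      using differentiable_at_real_polynomial_function[OF poly_dd[OF p(1)]]
      by (rule differentiable_imp_continuous_within)
    then show "(\<lambda>c::real. dd f v (c *\<^sub>R x)) \<midarrow>0\<rightarrow> dd f v (0 *\<^sub>R x)"
      by (intro isCont_tendsto_compose[of _ "\<lambda>x. dd f v x"] tendsto_intros)
    have "(\<lambda>c::real. c ^ (k - 1) * dd f v x) \<midarrow>0\<rightarrow> 0 ^ (k - 1) * dd f v x"
      by (intro tendsto_intros)
    then show "(\<lambda>c::real. dd f v (c *\<^sub>R x)) \<midarrow>0\<rightarrow> 0 ^ (k - 1) * dd f v x"
      by (rule Lim_transform_eventually) (auto simp: * eventually_at_filter)
  qed
  with * have "dd f v (c *\<^sub>R x) = c ^ (k - 1) * dd f v x" for c x
    by (cases "c = 0") blast+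
  then show ?thesis
    using poly_dd[OF p(1)] unfolding hom_polys_def by blast
qed

section \<open>Forms with polynomial coefficients\<close>

lemma sum_fun_apply: "(\<Sum>i\<in>I. f i) x = (\<Sum>i\<in>I. f i x)"
  for f :: "'i \<Rightarrow> 'a \<Rightarrow> 'b::comm_monoid_add"
  by (induction I rule: infinite_finite_induct) simp_all

lemma scaleR_fun_apply: "(c *\<^sub>R f) x = c *\<^sub>R f x"
  by (simp add: scaleR_fun_def)

lemma linear_expand:
  fixes f :: "'a::euclidean_space \<Rightarrow> real"
  assumes "linear f"
  shows "f x = (\<Sum>b\<in>Basis. (x \<bullet> b) * f b)"
proof -
  have "f x = f (\<Sum>b\<in>Basis. (x \<bullet> b) *\<^sub>R b)"
    by (simp add: euclidean_representation)
  also have "\<dots> = (\<Sum>b\<in>Basis. (x \<bullet> b) * f b)"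
    by (simp add: linear_sum[OF assms] linear_scale[OF assms])
  finally show ?thesis .
qed

text \<open>The domain on which \<open>ext_deriv\<close> and \<open>codiff\<close> are linear. It
  asks for neither alternation nor homogeneity, so it contains sums of forms of different
  degrees.\<close>

definition poly_coeffs :: "'m::finite dform set" where
  "poly_coeffs = {\<omega>. \<forall>vs. real_polynomial_function (\<lambda>x. \<omega> x vs)}"

lemma poly_coeffsD: "\<omega> \<in> poly_coeffs \<Longrightarrow> real_polynomial_function (\<lambda>x. \<omega> x vs)"
  by (simp add: poly_coeffs_def)

lemma poly_coeffs_sum: "(\<And>i. i \<in> I \<Longrightarrow> v i \<in> poly_coeffs) \<Longrightarrow> (\<Sum>i\<in>I. v i) \<in> poly_coeffs"
  by (cases "finite I")
    (simp_all add: poly_coeffs_def sum_fun_apply real_polynomial_function_sum real_polynomial_function.intros(2))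

lemma poly_formsD:
  assumes "\<omega> \<in> poly_forms s k"
  shows "\<omega> x \<in> alternating_forms s" "(\<lambda>x. \<omega> x vs) \<in> hom_polys k" "\<omega> \<in> poly_coeffs"
    "length vs \<noteq> s \<Longrightarrow> \<omega> x vs = 0"
proof -
  show a: "\<omega> x \<in> alternating_forms s" for x
    using assms by (simp add: poly_forms_def)
  show h: "(\<lambda>x. \<omega> x vs) \<in> hom_polys k" for vs
    using assms by (simp add: poly_forms_def)
  show "\<omega> \<in> poly_coeffs"
    unfolding poly_coeffs_def using hom_polysD(1)[OF h] by blast
  show "length vs \<noteq> s \<Longrightarrow> \<omega> x vs = 0"
    by (rule alternatingD(1)[OF a])
qed

lemma ext_deriv_eq_alt: "ext_deriv \<omega> x = alt (\<lambda>u zs. dd (\<lambda>y. \<omega> y zs) u x)"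
  by (rule ext) (simp add: ext_deriv_def alt_def)

section \<open>Linearity of the differential and the codifferential\<close>

lemma ext_deriv_add:
  "\<omega> \<in> poly_coeffs \<Longrightarrow> \<eta> \<in> poly_coeffs \<Longrightarrow> ext_deriv (\<omega> + \<eta>) = ext_deriv \<omega> + ext_deriv \<eta>"
  by (intro ext) (simp add: ext_deriv_eq_alt dd_add poly_coeffsD alt_add)

lemma ext_deriv_scaleR: "\<omega> \<in> poly_coeffs \<Longrightarrow> ext_deriv (c *\<^sub>R \<omega>) = c *\<^sub>R ext_deriv \<omega>"
  by (intro ext) (simp add: ext_deriv_eq_alt scaleR_fun_apply dd_cmult poly_coeffsD alt_cmult)

lemma ext_deriv_sum:
  assumes "\<And>i. i \<in> I \<Longrightarrow> v i \<in> poly_coeffs"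
  shows "ext_deriv (\<Sum>i\<in>I. v i) = (\<Sum>i\<in>I. ext_deriv (v i))"
  using assms
  by (intro ext) (simp add: ext_deriv_eq_alt sum_fun_apply dd_sum poly_coeffsD alt_sum)

lemma codiff_add:
  "\<omega> \<in> poly_coeffs \<Longrightarrow> \<eta> \<in> poly_coeffs \<Longrightarrow> codiff (\<omega> + \<eta>) = codiff \<omega> + codiff \<eta>"
  by (intro ext) (simp add: codiff_def dd_add poly_coeffsD sum.distrib)

lemma codiff_scaleR: "\<omega> \<in> poly_coeffs \<Longrightarrow> codiff (c *\<^sub>R \<omega>) = c *\<^sub>R codiff \<omega>"
  by (intro ext)
    (simp add: codiff_def scaleR_fun_apply dd_cmult poly_coeffsD sum_distrib_left)

lemma codiff_sum:
  assumes "\<And>i. i \<in> I \<Longrightarrow> v i \<in> poly_coeffs"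
  shows "codiff (\<Sum>i\<in>I. v i) = (\<Sum>i\<in>I. codiff (v i))"
proof (intro ext)
  fix x vs
  have "codiff (\<Sum>i\<in>I. v i) x vs = - (\<Sum>b\<in>Basis. \<Sum>i\<in>I. dd (\<lambda>y. v i y (b # vs)) b x)"
    using assms by (simp add: codiff_def sum_fun_apply dd_sum poly_coeffsD)
  also have "\<dots> = (\<Sum>i\<in>I. codiff (v i)) x vs"
    by (subst sum.swap) (simp add: codiff_def sum_fun_apply sum_negf)
  finally show "codiff (\<Sum>i\<in>I. v i) x vs = (\<Sum>i\<in>I. codiff (v i)) x vs" .
qed

section \<open>The squares of both operators vanish; degrees of their values\<close>

lemma poly_alt:
  fixes A :: "'a::euclidean_space \<Rightarrow> 'b \<Rightarrow> 'b list \<Rightarrow> real"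
  assumes "\<And>v zs. real_polynomial_function (\<lambda>y. A y v zs)"
  shows "real_polynomial_function (\<lambda>y. alt (A y) ws)"
  unfolding alt_def
  by (intro real_polynomial_function_sum real_polynomial_function.intros(2,4) assms) simp

lemma dd_alt:
  fixes A :: "'a::euclidean_space \<Rightarrow> 'b \<Rightarrow> 'b list \<Rightarrow> real"
  assumes "\<And>v zs. real_polynomial_function (\<lambda>y. A y v zs)"
  shows "dd (\<lambda>y. alt (A y) ws) u x = alt (\<lambda>v zs. dd (\<lambda>y. A y v zs) u x) ws"
  unfolding alt_def using assms
  by (simp add: dd_sum dd_cmult real_polynomial_function.intros(2,4))

lemma ext_deriv_poly_coeffs: "\<omega> \<in> poly_coeffs \<Longrightarrow> ext_deriv \<omega> \<in> poly_coeffs"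
  unfolding poly_coeffs_def ext_deriv_eq_alt mem_Collect_eq
  by (intro allI poly_alt poly_dd) blast

lemma ext_deriv_ext_deriv:
  assumes "\<omega> \<in> poly_coeffs"
  shows "ext_deriv (ext_deriv \<omega>) = 0"
proof (intro ext)
  fix x vs
  note p = poly_coeffsD[OF assms]
  have "ext_deriv (ext_deriv \<omega>) x vs =
      alt (\<lambda>u. alt (\<lambda>v zs. dd (\<lambda>y. dd (\<lambda>z. \<omega> z zs) v y) u x)) vs"
    by (simp add: ext_deriv_eq_alt dd_alt p poly_dd)
  also have "\<dots> = 0"
    by (rule alt_alt_symmetric) (rule dd_commute[OF p])
  finally show "ext_deriv (ext_deriv \<omega>) x vs = 0 x vs" by simp
qed

text \<open>Contraction with two basis vectors is antisymmetric in them while the second derivative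
  is symmetric, so the double sum over \<open>Basis\<close> equals its own negative.\<close>

lemma codiff_codiff:
  assumes \<omega>: "\<omega> \<in> poly_coeffs" and alt: "\<And>x. \<omega> x \<in> alternating_forms s"
  shows "codiff (codiff \<omega>) = 0"
proof (intro ext)
  fix x vs
  note p = poly_coeffsD[OF \<omega>]
  define X where "X c b = dd (\<lambda>y. dd (\<lambda>z. \<omega> z (b # c # vs)) b y) c x" for b c
  have "codiff (codiff \<omega>) x vs = (\<Sum>c\<in>Basis. \<Sum>b\<in>Basis. X c b)"
  proof -
    have "dd (\<lambda>y. - (\<Sum>b\<in>Basis. dd (\<lambda>z. \<omega> z (b # c # vs)) b y)) c x = - (\<Sum>b\<in>Basis. X c b)" for c
      using dd_cmult[of "\<lambda>y. \<Sum>b\<in>Basis. dd (\<lambda>z. \<omega> z (b # c # vs)) b y" "-1" x c]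
      by (simp add: X_def dd_sum p poly_dd real_polynomial_function_sum)
    then show ?thesis by (simp add: codiff_def sum_negf)
  qed
  moreover have "X c b = - X b c" for b c
  proof -
    have "X c b = dd (\<lambda>y. dd (\<lambda>z. \<omega> z (b # c # vs)) c y) b x"
      unfolding X_def by (rule dd_commute[OF p])
    also have "(\<lambda>z. \<omega> z (b # c # vs)) = (\<lambda>z. - 1 * \<omega> z (c # b # vs))"
      by (rule ext) (simp add: alternating_swap_hd[OF alt, of _ b c])
    finally show ?thesis
      unfolding X_def dd_cmult[OF p] dd_cmult[OF poly_dd[OF p]] by simp
  qed
  then have "(\<Sum>c\<in>Basis. \<Sum>b\<in>Basis. X c b) = - (\<Sum>c\<in>Basis. \<Sum>b\<in>Basis. X b c)"
    unfolding sum_negf[symmetric] by (intro sum.cong refl)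
  then have "(\<Sum>c\<in>Basis. \<Sum>b\<in>Basis. X c b) = - (\<Sum>c\<in>Basis. \<Sum>b\<in>Basis. X c b)"
    by (subst (asm) (2) sum.swap)
  ultimately show "codiff (codiff \<omega>) x vs = 0 x vs" by simp
qed

lemma dd_alternating:
  assumes \<omega>: "\<omega> \<in> poly_coeffs" and alt: "\<And>x. \<omega> x \<in> alternating_forms s"
  shows "(\<lambda>vs. dd (\<lambda>y. \<omega> y vs) u x) \<in> alternating_forms s"
proof -
  note p = poly_coeffsD[OF \<omega>]
  have "linear (\<lambda>v. dd (\<lambda>y. \<omega> y (us @ v # ws)) u x)" for us ws
  proof (rule linearI)
    show "dd (\<lambda>y. \<omega> y (us @ (a + b) # ws)) u x =
        dd (\<lambda>y. \<omega> y (us @ a # ws)) u x + dd (\<lambda>y. \<omega> y (us @ b # ws)) u x" for a b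
      by (simp add: linear_add[OF alternatingD(2)[OF alt]] dd_add p)
    show "dd (\<lambda>y. \<omega> y (us @ (c *\<^sub>R a) # ws)) u x = c *\<^sub>R dd (\<lambda>y. \<omega> y (us @ a # ws)) u x" for a c
      by (simp add: linear_scale[OF alternatingD(2)[OF alt]] dd_cmult p)
  qed
  then show ?thesis
    by (simp add: alternating_forms_def alternatingD(1,3)[OF alt])
qed

lemma ext_deriv_poly_forms:
  assumes "\<omega> \<in> poly_forms s k" "1 \<le> k"
  shows "ext_deriv \<omega> \<in> poly_forms (Suc s) (k - 1)"
proof -
  note \<omega> = poly_formsD[OF assms(1)]
  have "ext_deriv \<omega> x \<in> alternating_forms (Suc s)" for x
    unfolding ext_deriv_eq_alt
    by (rule alt_in_alternating_forms) (rule dd_alternating linear_dd poly_coeffsD \<omega>)+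
  moreover have "(\<lambda>x. ext_deriv \<omega> x vs) \<in> hom_polys (k - 1)" for vs
  proof -
    define c where "c i v x = (-1) ^ i * dd (\<lambda>y. \<omega> y (take i vs @ drop (Suc i) vs)) v x" for i v x
    have "c i v = (-1) ^ i *\<^sub>R (\<lambda>x. dd (\<lambda>y. \<omega> y (take i vs @ drop (Suc i) vs)) v x)" for i v
      by (rule ext) (simp add: c_def scaleR_fun_apply)
    then have "c i v \<in> hom_polys (k - 1)" for i v
      using subspace_scale[OF subspace_hom_polys dd_hom_polys[OF \<omega>(2) assms(2)]] by metis
    then have "(\<Sum>i<length vs. c i (vs ! i)) \<in> hom_polys (k - 1)"
      by (intro subspace_sum[OF subspace_hom_polys])
    also have "(\<Sum>i<length vs. c i (vs ! i)) = (\<lambda>x. ext_deriv \<omega> x vs)"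
      by (rule ext) (simp add: ext_deriv_def c_def sum_fun_apply)
    finally show ?thesis .
  qed
  ultimately show ?thesis by (simp add: poly_forms_def)
qed

text \<open>The degree condition uses \<open>Suc\<close> in place of \<open>s - 1\<close>. Thus
  \<open>s = 0\<close>, where \<open>codiff\<close> vanishes identically, is covered without
  truncated subtraction.\<close>

lemma codiff_eq_0:
  assumes "\<omega> \<in> poly_forms s k" "Suc (length vs) \<noteq> s"
  shows "codiff \<omega> x vs = 0"
  using poly_formsD(4)[OF assms(1)] assms(2) by (simp add: codiff_def)

section \<open>Contraction with the position vector and its adjoint\<close>

definition iota :: "'m::finite dform \<Rightarrow> 'm dform" where
  "iota \<omega> = (\<lambda>x vs. \<omega> x (x # vs))"

text \<open>Exterior multiplication by the 1-form sending \<open>u\<close> to the inner product of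
  \<open>x\<close> and \<open>u\<close>, which is the differential of half the squared norm.\<close>

definition wedge :: "'m::finite dform \<Rightarrow> 'm dform" where
  "wedge \<omega> = (\<lambda>x. alt (\<lambda>u zs. (x \<bullet> u) * \<omega> x zs))"

lemma inner_hom_polys: "(\<lambda>x. x \<bullet> v) \<in> hom_polys 1"
  by (simp add: hom_polys_def poly_linear linear_iff inner_left_distrib)

lemma hom_polys_mult: "f \<in> hom_polys j \<Longrightarrow> g \<in> hom_polys k \<Longrightarrow> (\<lambda>x. f x * g x) \<in> hom_polys (j + k)"
  by (simp add: hom_polys_def power_add real_polynomial_function.intros)

lemma hom_polys_sum:
  "(\<And>i. i \<in> I \<Longrightarrow> f i \<in> hom_polys k) \<Longrightarrow> (\<lambda>x. \<Sum>i\<in>I. f i x) \<in> hom_polys k"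
  using subspace_sum[OF subspace_hom_polys, of I f k] by (simp add: sum_fun_apply[abs_def])

lemma poly_inner: "real_polynomial_function (\<lambda>x. x \<bullet> v)"
  for v :: "'a::euclidean_space"
  by (intro poly_linear) (simp add: linear_iff inner_left_distrib)

lemma dd_inner: "dd (\<lambda>x. x \<bullet> v) u x = u \<bullet> v"
  by (intro dd_linear bounded_linear_inner_left)

section \<open>Commutation of both operators with contraction and exterior multiplication\<close>

context
  fixes h :: "'m::finite dform" and s k :: nat
  assumes h: "h \<in> poly_forms s k"
begin

text \<open>In \<open>iota h\<close> the point \<open>x\<close> is both base point and argument. The
  expansion in the basis turns this into a sum of products of polynomials, to which homogeneity and
  the product rule apply.\<close>

lemma iota_expand: "iota h x vs = (\<Sum>b\<in>Basis. (x \<bullet> b) * h x (b # vs))"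
  unfolding iota_def by (rule linear_expand[OF alternating_linear_hd[OF poly_formsD(1)[OF h]]])

lemma iota_poly_forms:
  assumes "s = Suc t"
  shows "iota h \<in> poly_forms t (Suc k)"
proof -
  note ha = poly_formsD(1)[OF h]
  have "linear (\<lambda>v. h x (x # us @ v # ws))" for x us ws
    using alternatingD(2)[OF ha[of x], of "x # us" ws] by simp
  moreover have "h x (x # us @ v # ws @ v # zs) = 0" for x us v ws zs
    using alternatingD(3)[OF ha[of x], of "x # us" v ws zs] by simp
  moreover have "h x (x # vs) = 0" if "length vs \<noteq> t" for x vs
    using that assms by (intro alternatingD(1)[OF ha]) simp
  moreover have "(\<lambda>x. iota h x vs) \<in> hom_polys (1 + k)" for vs
    unfolding iota_expand by (intro hom_polys_sum hom_polys_mult inner_hom_polys poly_formsD(2)[OF h])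
  ultimately show ?thesis
    by (simp add: poly_forms_def alternating_forms_def) (simp add: iota_def)
qed

lemma dd_iota: "dd (\<lambda>y. iota h y vs) u x = dd (\<lambda>y. h y (x # vs)) u x + h x (u # vs)"
proof -
  note p = poly_coeffsD[OF poly_formsD(3)[OF h]]
  have "dd (\<lambda>y. iota h y vs) u x =
      (\<Sum>b\<in>Basis. (x \<bullet> b) * dd (\<lambda>y. h y (b # vs)) u x) + (\<Sum>b\<in>Basis. (u \<bullet> b) * h x (b # vs))"
    unfolding iota_expand
    by (simp add: dd_sum dd_mult p poly_inner dd_inner real_polynomial_function.intros(4) sum.distrib)
  also have "(\<Sum>b\<in>Basis. (u \<bullet> b) * h x (b # vs)) = h x (u # vs)"
    by (rule linear_expand[OF alternating_linear_hd[OF poly_formsD(1)[OF h]], symmetric])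
  also have "(\<Sum>b\<in>Basis. (x \<bullet> b) * dd (\<lambda>y. h y (b # vs)) u x) = dd (\<lambda>y. h y (x # vs)) u x"
    by (rule linear_expand[OF alternating_linear_hd[OF dd_alternating], symmetric])
      (rule poly_formsD[OF h])+
  finally show ?thesis .
qed

text \<open>Cartan's formula for the Euler field. The product rule splits the first term into a
  mixed alternation and \<open>s\<close> times \<open>h\<close>; by \<open>alt_Cons\<close> the
  second term is the Euler term \<open>k\<close> times \<open>h\<close> minus the same mixed
  alternation.\<close>

lemma ext_deriv_iota: "ext_deriv (iota h) + iota (ext_deriv h) = (real k + real s) *\<^sub>R h"
proof (intro ext)
  fix x vs
  have "ext_deriv (iota h) x vs =
      alt (\<lambda>u zs. dd (\<lambda>y. h y (x # zs)) u x) vs + real (length vs) * h x vs"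
    unfolding ext_deriv_eq_alt dd_iota alt_add alt_alternating[OF poly_formsD(1)[OF h]] ..
  \<comment> \<open>Off length \<open>s\<close> both sides vanish, so the list length may be
    replaced by the degree.\<close>
  moreover have "real (length vs) * h x vs = real s * h x vs"
    using poly_formsD(4)[OF h, of vs x] by (cases "length vs = s") auto
  moreover have "iota (ext_deriv h) x vs = real k * h x vs - alt (\<lambda>u zs. dd (\<lambda>y. h y (x # zs)) u x) vs"
    unfolding ext_deriv_eq_alt iota_def alt_Cons euler_identity[OF poly_formsD(2)[OF h]] ..
  ultimately show "(ext_deriv (iota h) + iota (ext_deriv h)) x vs = ((real k + real s) *\<^sub>R h) x vs"
    by (simp add: scaleR_fun_apply distrib_right)
qed

text \<open>Differentiating the argument of \<open>iota\<close> yields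
  \<open>h x (b # b # vs) = 0\<close>; in the remaining term, exchanging \<open>x\<close> and
  \<open>b\<close> produces the minus sign.\<close>

lemma codiff_iota: "codiff (iota h) = - iota (codiff h)"
proof (intro ext)
  fix x vs
  note ha = poly_formsD(1)[OF h] and p = poly_coeffsD[OF poly_formsD(3)[OF h]]
  have "dd (\<lambda>y. h y (x # b # vs)) b x = - dd (\<lambda>y. h y (b # x # vs)) b x" for b
    by (rule alternating_swap_hd[OF dd_alternating]) (rule poly_formsD[OF h])+
  then show "codiff (iota h) x vs = (- iota (codiff h)) x vs"
    unfolding codiff_def dd_iota
    by (simp add: iota_def sum_negf alternating_repeat_hd(2)[OF ha])
qed

lemma wedge_poly_forms: "wedge h \<in> poly_forms (Suc s) (Suc k)"
proof -
  have "(\<lambda>zs. (x \<bullet> u) * h x zs) \<in> alternating_forms s" for x u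
    using subspace_scale[OF subspace_alternating_forms poly_formsD(1)[OF h], of "x \<bullet> u" x]
    by (simp add: scaleR_fun_def)
  then have "wedge h x \<in> alternating_forms (Suc s)" for x
    unfolding wedge_def
    by (intro alt_in_alternating_forms) (simp_all add: linear_iff inner_right_distrib distrib_right)
  moreover have "(\<lambda>x. wedge h x vs) \<in> hom_polys (Suc k)" for vs
  proof -
    have "(\<lambda>x. c * ((x \<bullet> v) * h x zs)) \<in> hom_polys (Suc k)" for c v zs
      using subspace_scale[OF subspace_hom_polys
          hom_polys_mult[OF inner_hom_polys poly_formsD(2)[OF h]], of c v zs]
      by (simp add: scaleR_fun_def)
    then show ?thesis
      unfolding wedge_def alt_def by (intro hom_polys_sum)
  qed
  ultimately show ?thesis by (simp add: poly_forms_def)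
qed

lemma dd_wedge:
  "dd (\<lambda>y. wedge h y vs) u x =
    alt (\<lambda>v zs. (u \<bullet> v) * h x zs) vs + alt (\<lambda>v zs. (x \<bullet> v) * dd (\<lambda>y. h y zs) u x) vs"
proof -
  note p = poly_coeffsD[OF poly_formsD(3)[OF h]]
  show ?thesis
    unfolding wedge_def
    by (simp add: dd_alt dd_mult p poly_inner dd_inner real_polynomial_function.intros(4) add.commute
        flip: alt_add)
qed

text \<open>The derivative of the 1-form is the inner product of \<open>u\<close> and
  \<open>v\<close>, which is symmetric and hence killed by the double alternation. The other term
  changes sign under \<open>alt_alt_swap\<close>.\<close>

lemma ext_deriv_wedge: "ext_deriv (wedge h) = - wedge (ext_deriv h)"
proof (intro ext)
  fix x vs
  have "ext_deriv (wedge h) x vs = alt (\<lambda>u. alt (\<lambda>v zs. (u \<bullet> v) * h x zs)) vs +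
      alt (\<lambda>u. alt (\<lambda>v zs. (x \<bullet> v) * dd (\<lambda>y. h y zs) u x)) vs"
    unfolding ext_deriv_eq_alt dd_wedge by (rule alt_add)
  also have "alt (\<lambda>u. alt (\<lambda>v zs. (u \<bullet> v) * h x zs)) vs = 0"
    by (rule alt_alt_symmetric) (simp add: inner_commute)
  also have "alt (\<lambda>u. alt (\<lambda>v zs. (x \<bullet> v) * dd (\<lambda>y. h y zs) u x)) vs = - wedge (ext_deriv h) x vs"
    unfolding wedge_def ext_deriv_eq_alt alt_cmult[symmetric] by (rule alt_alt_swap)
  finally show "ext_deriv (wedge h) x vs = (- wedge (ext_deriv h)) x vs"
    by simp
qed

text \<open>The dual of Cartan's formula. On \<open>b # vs\<close>, \<open>alt_Cons\<close>
  separates the summands that remove \<open>b\<close>: they contribute the dimension, as the sum of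
  the squared norms of the basis vectors, and the Euler term \<open>e\<close>. The other summands
  are subtracted and give the degree \<open>l\<close> and the commuted operator
  \<open>w\<close>.\<close>

lemma codiff_wedge:
  "codiff (wedge h) + wedge (codiff h) = - ((real k + real CARD('m) - real s) *\<^sub>R h)"
proof (intro ext)
  fix x vs
  note ha = poly_formsD(1)[OF h] and p = poly_coeffsD[OF poly_formsD(3)[OF h]]
  have l: "(\<Sum>b\<in>Basis. alt (\<lambda>v zs. (b \<bullet> v) * h x (b # zs)) vs) = real s * h x vs"
  proof -
    have "(\<Sum>b\<in>Basis. (b \<bullet> v) * h x (b # zs)) = h x (v # zs)" for v zs
      using linear_expand[OF alternating_linear_hd[OF ha], of x v zs] by (simp add: inner_commute)
    then have "(\<Sum>b\<in>Basis. alt (\<lambda>v zs. (b \<bullet> v) * h x (b # zs)) vs) = real (length vs) * h x vs"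
      unfolding alt_sum[symmetric] by (simp add: alt_alternating[OF ha])
    then show ?thesis
      using poly_formsD(4)[OF h, of vs x] by (cases "length vs = s") auto
  qed
  have w: "(\<Sum>b\<in>Basis. alt (\<lambda>v zs. (x \<bullet> v) * dd (\<lambda>y. h y (b # zs)) b x) vs) = - wedge (codiff h) x vs"
    unfolding alt_sum[symmetric] wedge_def alt_minus[symmetric]
    by (simp add: codiff_def sum_distrib_left)
  have e: "(\<Sum>b\<in>Basis. (x \<bullet> b) * dd (\<lambda>y. h y vs) b x) = real k * h x vs"
    using linear_expand[OF linear_dd[OF p[of vs]], of x x] euler_identity[OF poly_formsD(2)[OF h]]
    by simp
  have "codiff (wedge h) x vs = - (\<Sum>b\<in>Basis. (b \<bullet> b) * h x vs + (x \<bullet> b) * dd (\<lambda>y. h y vs) b x -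
      (alt (\<lambda>v zs. (b \<bullet> v) * h x (b # zs)) vs + alt (\<lambda>v zs. (x \<bullet> v) * dd (\<lambda>y. h y (b # zs)) b x) vs))"
    unfolding codiff_def dd_wedge alt_Cons by (simp add: algebra_simps)
  also have "(\<Sum>b\<in>Basis. (b \<bullet> b) * h x vs + (x \<bullet> b) * dd (\<lambda>y. h y vs) b x -
      (alt (\<lambda>v zs. (b \<bullet> v) * h x (b # zs)) vs + alt (\<lambda>v zs. (x \<bullet> v) * dd (\<lambda>y. h y (b # zs)) b x) vs)) =
      (\<Sum>b\<in>(Basis :: (real^'m) set). h x vs) + real k * h x vs - (real s * h x vs - wedge (codiff h) x vs)"
    by (simp add: sum.distrib sum_subtractf l w e)
  finally show "(codiff (wedge h) + wedge (codiff h)) x vs =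
      (- ((real k + real CARD('m) - real s) *\<^sub>R h)) x vs"
    by (simp add: scaleR_fun_apply algebra_simps)
qed

end

section \<open>The action of the orthogonal group\<close>

text \<open>The trace of a bilinear form is the same in every orthonormal basis. Both slots are
  expanded in the standard basis, and the sum over \<open>b\<close> of the products of coefficients
  is the inner product of \<open>inv g c\<close> and \<open>inv g d\<close>.\<close>

lemma sum_Basis_orthogonal:
  fixes B :: "'a::euclidean_space \<Rightarrow> 'a \<Rightarrow> real" and g :: "'a \<Rightarrow> 'a"
  assumes l: "\<And>v. linear (\<lambda>u. B u v)" and r: "\<And>u. linear (B u)"
    and g: "orthogonal_transformation g"
  shows "(\<Sum>b\<in>Basis. B (g b) (g b)) = (\<Sum>b\<in>Basis. B b b)"
proof -
  let ?G = "inv g"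
  have gi: "g x \<bullet> y = x \<bullet> ?G y" for x y
  proof -
    have "g x \<bullet> g (?G y) = x \<bullet> ?G y"
      using g by (simp add: orthogonal_transformation_def)
    then show ?thesis
      by (simp add: surj_f_inv_f[OF orthogonal_transformation_surj[OF g]])
  qed
  have "B (g b) (g b) = (\<Sum>c\<in>Basis. \<Sum>d\<in>Basis. (b \<bullet> ?G c) * (b \<bullet> ?G d) * B c d)" for b
    by (subst linear_expand[OF l], subst linear_expand[OF r])
      (simp add: gi sum_distrib_left mult_ac)
  then have "(\<Sum>b\<in>Basis. B (g b) (g b)) =
      (\<Sum>b\<in>Basis. \<Sum>c\<in>Basis. \<Sum>d\<in>Basis. (b \<bullet> ?G c) * (b \<bullet> ?G d) * B c d)"
    by simp
  also have "\<dots> = (\<Sum>c\<in>Basis. \<Sum>d\<in>Basis. \<Sum>b\<in>Basis. (b \<bullet> ?G c) * (b \<bullet> ?G d) * B c d)"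
    by (subst sum.swap, rule sum.cong[OF refl], rule sum.swap)
  also have "\<dots> = (\<Sum>c\<in>Basis. \<Sum>d\<in>Basis. (c \<bullet> d) * B c d)"
  proof (intro sum.cong refl)
    fix c d
    have "(\<Sum>b\<in>Basis. (b \<bullet> ?G c) * (b \<bullet> ?G d)) = ?G c \<bullet> ?G d"
      by (subst euclidean_inner) (simp add: inner_commute)
    also have "\<dots> = c \<bullet> d"
      using orthogonal_transformation_inv[OF g] by (simp add: orthogonal_transformation_def)
    finally show "(\<Sum>b\<in>Basis. (b \<bullet> ?G c) * (b \<bullet> ?G d) * B c d) = (c \<bullet> d) * B c d"
      by (simp flip: sum_distrib_right)
  qed
  also have "\<dots> = (\<Sum>c\<in>Basis. B c c)"
  proof (intro sum.cong refl)
    fix c :: 'a assume c: "c \<in> Basis"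
    show "(\<Sum>d\<in>Basis. (c \<bullet> d) * B c d) = B c c"
      using linear_expand[OF r, of c c] by simp
  qed
  finally show ?thesis .
qed

context
  fixes g :: "real^'m::finite \<Rightarrow> real^'m"
  assumes g: "orthogonal_transformation g"
begin

lemma orthogonal_inv: "orthogonal_transformation (inv g)"
  by (rule orthogonal_transformation_inv[OF g])

lemma linear_orthogonal_inv: "linear (inv g)"
  by (rule orthogonal_transformation_linear[OF orthogonal_inv])

lemma form_act_poly_forms:
  assumes "\<omega> \<in> poly_forms s k"
  shows "form_act g \<omega> \<in> poly_forms s k"
proof -
  note a = alternatingD[OF poly_formsD(1)[OF assms]]
  have "linear (\<lambda>v. \<omega> x (map (inv g) us @ inv g v # map (inv g) ws))" for x us ws
    using linear_compose[OF linear_orthogonal_inv a(2)] by (simp add: o_def)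
  then have "form_act g \<omega> x \<in> alternating_forms s" for x
    using a(1,3) by (simp add: alternating_forms_def form_act_def)
  moreover have "(\<lambda>x. form_act g \<omega> x vs) \<in> hom_polys k" for vs
    using hom_polysD[OF poly_formsD(2)[OF assms, of "map (inv g) vs"]]
      poly_compose_linear[OF _ linear_orthogonal_inv, of "\<lambda>x. \<omega> x (map (inv g) vs)"]
    by (simp add: hom_polys_def form_act_def linear_scale[OF linear_orthogonal_inv])
  ultimately show ?thesis by (simp add: poly_forms_def)
qed

lemma dd_form_act:
  assumes "\<omega> \<in> poly_coeffs"
  shows "dd (\<lambda>y. form_act g \<omega> y vs) u x = dd (\<lambda>y. \<omega> y (map (inv g) vs)) (inv g u) (inv g x)"
  unfolding form_act_def by (rule dd_compose_linear[OF poly_coeffsD[OF assms] linear_orthogonal_inv])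

lemma ext_deriv_form_act:
  assumes "\<omega> \<in> poly_coeffs"
  shows "ext_deriv (form_act g \<omega>) = form_act g (ext_deriv \<omega>)"
  by (intro ext) (simp add: ext_deriv_eq_alt dd_form_act[OF assms] form_act_def[of g "ext_deriv \<omega>"] alt_map)

text \<open>By the chain rule the left side is minus the trace of the bilinear form
  \<open>?B\<close> over the vectors \<open>inv g b\<close>; these are again an orthonormal basis.
  Alternation supplies linearity of \<open>?B\<close> in its second slot.\<close>

lemma codiff_form_act:
  assumes \<omega>: "\<omega> \<in> poly_coeffs" and alt: "\<And>x. \<omega> x \<in> alternating_forms s"
  shows "codiff (form_act g \<omega>) = form_act g (codiff \<omega>)"
proof (intro ext)
  fix x vs
  let ?B = "\<lambda>u v. dd (\<lambda>y. \<omega> y (v # map (inv g) vs)) u (inv g x)"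
  have "linear (\<lambda>u. ?B u v)" for v
    by (rule linear_dd[OF poly_coeffsD[OF \<omega>]])
  moreover have "linear (?B u)" for u
    by (rule alternating_linear_hd[OF dd_alternating[OF \<omega> alt]])
  ultimately have "(\<Sum>b\<in>Basis. ?B (inv g b) (inv g b)) = (\<Sum>b\<in>Basis. ?B b b)"
    by (rule sum_Basis_orthogonal[OF _ _ orthogonal_inv])
  then show "codiff (form_act g \<omega>) x vs = form_act g (codiff \<omega>) x vs"
    by (simp add: codiff_def dd_form_act[OF \<omega>]) (simp add: form_act_def)
qed

lemma iota_form_act: "iota (form_act g \<omega>) = form_act g (iota \<omega>)"
  by (simp add: iota_def form_act_def)

lemma wedge_form_act: "wedge (form_act g \<omega>) = form_act g (wedge \<omega>)"
proof (intro ext)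
  fix x vs
  have "x \<bullet> u = inv g x \<bullet> inv g u" for u
    using orthogonal_inv by (simp add: orthogonal_transformation_def)
  then show "wedge (form_act g \<omega>) x vs = form_act g (wedge \<omega>) x vs"
    by (simp add: wedge_def form_act_def alt_map)
qed

end

lemma form_act_add: "form_act g (\<omega> + \<eta>) = form_act g \<omega> + form_act g \<eta>"
  by (intro ext) (simp add: form_act_def)

lemma form_act_diff: "form_act g (\<omega> - \<eta>) = form_act g \<omega> - form_act g \<eta>"
  by (intro ext) (simp add: form_act_def)

lemma form_act_zero: "form_act g 0 = 0"
  by (intro ext) (simp add: form_act_def)

lemma form_act_sum: "form_act g (\<Sum>i\<in>I. v i) = (\<Sum>i\<in>I. form_act g (v i))"
  by (intro ext) (simp add: form_act_def sum_fun_apply)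

section \<open>The equivariant splitting\<close>

text \<open>The scalars depend on the length of the argument list, so that one map serves all degrees
  at once: \<open>s\<close> is \<open>length vs + 1\<close> in the first summand and \<open>length vs - 1\<close> in the second.\<close>

definition splitting :: "nat \<Rightarrow> 'm::finite dform \<Rightarrow> 'm dform" where
  "splitting k \<omega> = (\<lambda>x vs. iota \<omega> x vs / (real k + real (length vs)) +
     wedge \<omega> x vs / (real k + real CARD('m) - real (length vs)))"

lemma wedge_add: "wedge (\<omega> + \<eta>) = wedge \<omega> + wedge \<eta>"
  by (intro ext) (simp add: wedge_def distrib_left alt_add)

lemma wedge_scaleR: "wedge (c *\<^sub>R \<omega>) = c *\<^sub>R wedge \<omega>"
  by (intro ext) (simp add: wedge_def scaleR_fun_apply mult.left_commute[of _ c] alt_cmult)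

lemma splitting_add: "splitting k (\<omega> + \<eta>) = splitting k \<omega> + splitting k \<eta>"
  by (intro ext) (simp add: splitting_def wedge_add iota_def add_divide_distrib)

lemma splitting_scaleR: "splitting k (c *\<^sub>R \<omega>) = c *\<^sub>R splitting k \<omega>"
  by (intro ext) (simp add: splitting_def wedge_scaleR iota_def scaleR_fun_apply distrib_left)

lemma splitting_sum: "splitting k (\<Sum>i\<in>I. v i) = (\<Sum>i\<in>I. splitting k (v i))"
proof -
  have "splitting k 0 = 0"
    using splitting_scaleR[of k 0 0] by simp
  then show ?thesis
    by (induction I rule: infinite_finite_induct) (simp_all add: splitting_add)
qed

text \<open>The action maps the argument list elementwise and so preserves its length, hence also
  the scalars in \<open>splitting\<close>.\<close>

lemma splitting_form_act:
  "orthogonal_transformation g \<Longrightarrow> splitting k (form_act g \<omega>) = form_act g (splitting k \<omega>)"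
  unfolding splitting_def by (simp add: iota_form_act wedge_form_act) (simp add: form_act_def)

text \<open>The pieces \<open>u\<close> and \<open>v\<close> are the contraction and the exterior
  product, normalised so that \<open>ext_deriv u\<close> and \<open>codiff v\<close> cancel in the
  Moisil-Theodoresco equation while the other two derivatives vanish.\<close>

lemma splitting_Hodge:
  fixes h :: "'m::finite dform"
  assumes h: "h \<in> Hodge (Suc t) (k - 1)" and k: "1 \<le> k" and t: "t + 2 \<le> CARD('m)"
  obtains u v where "splitting k h = u + v" "u \<in> poly_forms t k" "v \<in> poly_forms (t + 2) k"
    "ext_deriv u = h" "codiff u = 0" "ext_deriv v = 0" "codiff v = - h"
proof
  have h': "h \<in> poly_forms (Suc t) (k - 1)" and d: "ext_deriv h = 0" and c: "codiff h = 0"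
    using h by (simp_all add: Hodge_def)
  \<comment> \<open>The Cartan constants for form degree \<open>t + 1\<close> and coefficient degree
    \<open>k - 1\<close>: \<open>(k - 1) + (t + 1)\<close> for \<open>a\<close> and
    \<open>(k - 1) + CARD('m) - (t + 1)\<close> for \<open>b\<close>. The bound on \<open>t\<close>
    makes \<open>b\<close> at least \<open>k\<close>.\<close>
  define a where "a = real k + real t"
  define b where "b = real k + real CARD('m) - real (t + 2)"
  have a0: "a \<noteq> 0" and b0: "b \<noteq> 0"
    using k t unfolding a_def b_def by linarith+
  have i: "iota h \<in> poly_forms t k" and w: "wedge h \<in> poly_forms (t + 2) k"
    using iota_poly_forms[OF h' refl] wedge_poly_forms[OF h'] k by simp_all
  have z: "iota 0 = (0 :: 'm dform)" "wedge 0 = (0 :: 'm dform)"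
    using wedge_scaleR[of 0 0] by (simp_all add: iota_def fun_eq_iff)
  show "splitting k h = (1 / a) *\<^sub>R iota h + (1 / b) *\<^sub>R wedge h"
  proof (intro ext)
    fix x vs
    \<comment> \<open>Length \<open>t\<close> selects the contraction and length
      \<open>t + 2\<close> the exterior product. At every other length both numerators are zero,
      whatever the denominators.\<close>
    show "splitting k h x vs = ((1 / a) *\<^sub>R iota h + (1 / b) *\<^sub>R wedge h) x vs"
      using poly_formsD(4)[OF i, of vs x] poly_formsD(4)[OF w, of vs x]
      by (cases "length vs = t"; cases "length vs = t + 2")
        (simp_all add: splitting_def scaleR_fun_apply a_def b_def)
  qed
  show "(1 / a) *\<^sub>R iota h \<in> poly_forms t k" "(1 / b) *\<^sub>R wedge h \<in> poly_forms (t + 2) k"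
    by (rule subspace_scale[OF subspace_poly_forms] i w)+
  note pi = poly_formsD(3)[OF i] and pw = poly_formsD(3)[OF w]
  have "ext_deriv (iota h) = a *\<^sub>R h"
    using ext_deriv_iota[OF h'] k by (simp add: d z a_def of_nat_diff)
  then show "ext_deriv ((1 / a) *\<^sub>R iota h) = h"
    by (simp add: ext_deriv_scaleR[OF pi] a0)
  show "codiff ((1 / a) *\<^sub>R iota h) = 0"
    by (simp add: codiff_scaleR[OF pi] codiff_iota[OF h'] c z)
  show "ext_deriv ((1 / b) *\<^sub>R wedge h) = 0"
    by (simp add: ext_deriv_scaleR[OF pw] ext_deriv_wedge[OF h'] d z)
  have "real (k - 1) + real CARD('m) - real (Suc t) = b"
    using k by (simp add: b_def of_nat_diff)
  then have "codiff (wedge h) = - (b *\<^sub>R h)"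
    using codiff_wedge[OF h'] by (simp add: c z)
  then show "codiff ((1 / b) *\<^sub>R wedge h) = - h"
    by (simp add: codiff_scaleR[OF pw] b0)
qed

section \<open>Graded components\<close>

text \<open>The shift \<open>t\<close> serves both operators: the identity for
  \<open>ext_deriv\<close>, and \<open>Suc\<close> for \<open>codiff\<close>, whose values have
  degree one less than their argument.\<close>

lemma graded_sum_apply:
  fixes w :: "'i \<Rightarrow> 'a \<Rightarrow> 'b list \<Rightarrow> real"
  assumes "finite I" and deg: "inj_on deg I"
    and w: "\<And>j. j \<in> I \<Longrightarrow> t (length vs) \<noteq> deg j \<Longrightarrow> w j x vs = 0"
    and i: "i \<in> I" "t (length vs) = deg i"
  shows "(\<Sum>j\<in>I. w j) x vs = w i x vs"
proof -
  have "w j x vs = (if j = i then w i x vs else 0)" if "j \<in> I" for j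
  proof (cases "j = i")
    case False
    then have "t (length vs) \<noteq> deg j"
      using inj_onD[OF deg _ i(1) that] i(2) by (metis)
    then show ?thesis
      using w[OF that] False by simp
  qed simp
  then have "(\<Sum>j\<in>I. w j x vs) = (\<Sum>j\<in>I. if j = i then w i x vs else 0)"
    by (rule sum.cong[OF refl])
  then show ?thesis
    using i(1) \<open>finite I\<close> by (simp add: sum_fun_apply)
qed

lemma graded_sum_zero:
  fixes w :: "'i \<Rightarrow> 'a \<Rightarrow> 'b list \<Rightarrow> real"
  assumes "finite I" and deg: "inj_on deg I"
    and w: "\<And>j x vs. j \<in> I \<Longrightarrow> t (length vs) \<noteq> deg j \<Longrightarrow> w j x vs = 0"
    and zero: "(\<Sum>j\<in>I. w j) = 0" and i: "i \<in> I"
  shows "w i = 0"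
proof (intro ext)
  fix x vs
  show "w i x vs = 0 x vs"
  proof (cases "t (length vs) = deg i")
    case True
    then show ?thesis
      using graded_sum_apply[where w = w and t = t and x = x, OF assms(1) deg w i] zero by simp
  qed (simp add: w[OF i])
qed

lemma subspace_Hodge: "subspace (Hodge s k :: 'm::finite dform set)"
proof (rule subspaceI)
  have "ext_deriv (0 :: 'm dform) = 0" "codiff (0 :: 'm dform) = 0"
    using ext_deriv_scaleR[of 0 0] codiff_scaleR[of 0 0]
    by (simp_all add: poly_formsD(3)[OF subspace_0[OF subspace_poly_forms]])
  then show "0 \<in> (Hodge s k :: 'm dform set)"
    by (simp add: Hodge_def subspace_0[OF subspace_poly_forms])
next
  fix \<omega> \<eta> :: "'m dform" assume "\<omega> \<in> Hodge s k" "\<eta> \<in> Hodge s k"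
  then show "\<omega> + \<eta> \<in> Hodge s k"
    using poly_formsD(3)[of \<omega> s k] poly_formsD(3)[of \<eta> s k]
    by (simp add: Hodge_def subspace_add[OF subspace_poly_forms] ext_deriv_add codiff_add)
next
  fix c and \<omega> :: "'m dform" assume "\<omega> \<in> Hodge s k"
  then show "c *\<^sub>R \<omega> \<in> Hodge s k"
    using poly_formsD(3)[of \<omega> s k]
    by (simp add: Hodge_def subspace_scale[OF subspace_poly_forms] ext_deriv_scaleR codiff_scaleR)
qed

text \<open>Distinct degrees make the sum direct, so for kernel and image it remains to prove the
  set equality in the last assumption.\<close>

lemma is_direct_sum_Hodge:
  assumes "finite I" "inj_on deg I" "W = sum_of_spaces I (\<lambda>j. Hodge (deg j) k)"
  shows "is_direct_sum (W :: 'm::finite dform set) I (\<lambda>j. Hodge (deg j) k)"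
  unfolding is_direct_sum_def
proof (intro conjI ballI allI impI)
  fix v :: "_ \<Rightarrow> 'm dform" and i
  assume v: "(\<forall>i\<in>I. v i \<in> Hodge (deg i) k) \<and> (\<Sum>i\<in>I. v i) = 0" and i: "i \<in> I"
  show "v i = 0"
  proof (rule graded_sum_zero[OF assms(1,2), where t = "\<lambda>n. n"])
    show "v j x vs = 0" if "j \<in> I" "length vs \<noteq> deg j" for j x vs
      using v that poly_formsD(4)[of "v j" "deg j" k vs x] by (auto simp: Hodge_def)
  qed (use v i in auto)
qed (use assms subspace_Hodge in auto)

section \<open>Sums of subspaces and the space of Moisil-Theodoresco solutions\<close>

lemma subspace_sum_of_spaces:
  assumes "\<And>i. i \<in> I \<Longrightarrow> subspace (V i)"
  shows "subspace (sum_of_spaces I V)"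
proof (rule subspaceI)
  show "0 \<in> sum_of_spaces I V"
    unfolding sum_of_spaces_def using subspace_0[OF assms]
    by (intro CollectI exI[of _ "\<lambda>_. 0"]) simp
next
  fix a b assume "a \<in> sum_of_spaces I V" "b \<in> sum_of_spaces I V"
  then obtain v w where "a = sum v I" "b = sum w I" "\<forall>i\<in>I. v i \<in> V i" "\<forall>i\<in>I. w i \<in> V i"
    unfolding sum_of_spaces_def by blast
  then show "a + b \<in> sum_of_spaces I V"
    unfolding sum_of_spaces_def using subspace_add[OF assms]
    by (intro CollectI exI[of _ "\<lambda>i. v i + w i"]) (simp add: sum.distrib)
next
  fix c a assume "a \<in> sum_of_spaces I V"
  then obtain v where "a = sum v I" "\<forall>i\<in>I. v i \<in> V i"
    unfolding sum_of_spaces_def by blast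
  then show "c *\<^sub>R a \<in> sum_of_spaces I V"
    unfolding sum_of_spaces_def using subspace_scale[OF assms]
    by (intro CollectI exI[of _ "\<lambda>i. c *\<^sub>R v i"]) (simp add: scaleR_sum_right)
qed

lemma sum_of_spaces_member:
  assumes "finite I" "\<And>i. i \<in> I \<Longrightarrow> subspace (V i)" "i \<in> I" "a \<in> V i"
  shows "a \<in> sum_of_spaces I V"
  unfolding sum_of_spaces_def using assms subspace_0[OF assms(2)]
  by (intro CollectI exI[of _ "\<lambda>j. if j = i then a else 0"]) simp

lemma poly_forms_rpqE:
  assumes "P \<in> poly_forms_rpq r p q k"
  obtains v where "P = (\<Sum>j=p..q. v j)" "\<And>j. j \<in> {p..q} \<Longrightarrow> v j \<in> poly_forms (r + 2 * j) k"
  using assms unfolding poly_forms_rpq_def sum_of_spaces_def by blast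

lemma poly_forms_rpq_poly_coeffs:
  assumes "P \<in> poly_forms_rpq r p q k"
  shows "P \<in> poly_coeffs"
proof -
  obtain v where "P = (\<Sum>j=p..q. v j)" "\<And>j. j \<in> {p..q} \<Longrightarrow> v j \<in> poly_forms (r + 2 * j) k"
    using poly_forms_rpqE[OF assms] by metis
  then show ?thesis by (metis poly_coeffs_sum poly_formsD(3))
qed

lemma subspace_poly_forms_rpq: "subspace (poly_forms_rpq r p q k)"
  unfolding poly_forms_rpq_def by (intro subspace_sum_of_spaces subspace_poly_forms)

lemma MT_D:
  assumes "P \<in> MT r p q k"
  shows "P \<in> poly_forms_rpq r p q k" "P \<in> poly_coeffs" "ext_deriv P + codiff P = 0"
  using assms poly_forms_rpq_poly_coeffs by (auto simp: MT_def)

lemma subspace_MT: "subspace (MT r p q k :: 'm::finite dform set)"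
proof (rule subspaceI)
  have s: "subspace (poly_forms_rpq r p q k :: 'm dform set)"
    by (rule subspace_poly_forms_rpq)
  have "ext_deriv (0 :: 'm dform) = 0" "codiff (0 :: 'm dform) = 0"
    using ext_deriv_scaleR[of 0 0] codiff_scaleR[of 0 0]
    by (simp_all add: poly_formsD(3)[OF subspace_0[OF subspace_poly_forms]])
  then show "0 \<in> (MT r p q k :: 'm dform set)"
    by (simp add: MT_def subspace_0[OF s])
  show "\<omega> + \<eta> \<in> MT r p q k" if "\<omega> \<in> MT r p q k" "\<eta> \<in> MT r p q k" for \<omega> \<eta> :: "'m dform"
  proof -
    have "ext_deriv (\<omega> + \<eta>) + codiff (\<omega> + \<eta>) = (ext_deriv \<omega> + codiff \<omega>) + (ext_deriv \<eta> + codiff \<eta>)"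
      by (simp add: ext_deriv_add codiff_add MT_D(2)[OF that(1)] MT_D(2)[OF that(2)])
    then show ?thesis
      using subspace_add[OF s MT_D(1)[OF that(1)] MT_D(1)[OF that(2)]] MT_D(3)[OF that(1)] MT_D(3)[OF that(2)]
      by (simp add: MT_def)
  qed
  show "c *\<^sub>R \<omega> \<in> MT r p q k" if "\<omega> \<in> MT r p q k" for c and \<omega> :: "'m dform"
  proof -
    have "ext_deriv (c *\<^sub>R \<omega>) + codiff (c *\<^sub>R \<omega>) = c *\<^sub>R (ext_deriv \<omega> + codiff \<omega>)"
      by (simp add: ext_deriv_scaleR codiff_scaleR MT_D(2)[OF that] scaleR_add_right)
    then show ?thesis
      using subspace_scale[OF s MT_D(1)[OF that]] MT_D(3)[OF that] by (simp add: MT_def)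
  qed
qed

lemma form_act_MT:
  assumes g: "orthogonal_transformation g" and P: "P \<in> MT r p q k"
  shows "form_act g P \<in> MT r p q k"
proof -
  obtain v where P_eq: "P = (\<Sum>j=p..q. v j)"
    and v: "\<And>j. j \<in> {p..q} \<Longrightarrow> v j \<in> poly_forms (r + 2 * j) k"
    using poly_forms_rpqE[OF MT_D(1)[OF P]] by metis
  have gv: "form_act g (v j) \<in> poly_forms (r + 2 * j) k" if "j \<in> {p..q}" for j
    by (rule form_act_poly_forms[OF g v[OF that]])
  then have "form_act g P \<in> poly_forms_rpq r p q k"
    unfolding P_eq form_act_sum poly_forms_rpq_def sum_of_spaces_def by blast
  \<comment> \<open>Equivariance of \<open>codiff\<close> is available for forms of a single degree
    only, so it is applied to the components.\<close>
  moreover have "codiff (form_act g P) = form_act g (codiff P)"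
  proof -
    have "codiff (form_act g P) = (\<Sum>j=p..q. codiff (form_act g (v j)))"
      unfolding P_eq form_act_sum by (rule codiff_sum[OF poly_formsD(3)[OF gv]])
    also have "\<dots> = (\<Sum>j=p..q. form_act g (codiff (v j)))"
      by (rule sum.cong[OF refl]) (metis codiff_form_act[OF g] poly_formsD(1,3) v)
    also have "\<dots> = form_act g (codiff P)"
      unfolding P_eq form_act_sum[symmetric] by (rule arg_cong[OF codiff_sum[OF poly_formsD(3)[OF v], symmetric]])
    finally show ?thesis .
  qed
  then have "ext_deriv (form_act g P) + codiff (form_act g P) = form_act g (ext_deriv P + codiff P)"
    by (simp add: ext_deriv_form_act[OF g MT_D(2)[OF P]] form_act_add)
  then have "ext_deriv (form_act g P) + codiff (form_act g P) = 0"
    by (simp add: MT_D(3)[OF P] form_act_zero)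
  ultimately show ?thesis by (simp add: MT_def)
qed

section \<open>Kernel and image of the de Rham differential\<close>

lemma inj_degrees:
  fixes r :: nat
  shows "inj_on (\<lambda>j. r + 2 * j) J" "inj_on (\<lambda>j. r + 2 * j + 1) J"
  by (simp_all add: inj_on_def)

context
  fixes r p q k :: nat
  assumes k: "1 \<le> k"
begin

lemma ext_deriv_graded:
  assumes "v \<in> poly_forms (r + 2 * j) k" "length vs \<noteq> r + 2 * j + 1"
  shows "ext_deriv v x vs = 0"
  using poly_formsD(4)[OF ext_deriv_poly_forms[OF assms(1) k]] assms(2) by simp

lemma codiff_graded:
  assumes "v \<in> poly_forms (r + 2 * j) k" "Suc (length vs) \<noteq> r + 2 * j"
  shows "codiff v x vs = 0"
  using codiff_eq_0[OF assms] .

text \<open>In degree \<open>r + 2 * j + 1\<close> the equation involves only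
  \<open>ext_deriv (v j)\<close> and \<open>codiff (v (Suc j))\<close>. In the top degree
  \<open>r + 2 * q + 1\<close> the second of these is absent.\<close>

lemma MT_components:
  fixes P :: "'m::finite dform"
  assumes P: "P \<in> MT r p q k" and P_eq: "P = (\<Sum>j=p..q. v j)"
    and v: "\<And>j. j \<in> {p..q} \<Longrightarrow> v j \<in> poly_forms (r + 2 * j) k"
  shows "p \<le> j \<Longrightarrow> j < q \<Longrightarrow> ext_deriv (v j) = - codiff (v (Suc j))"
    and "p \<le> q \<Longrightarrow> ext_deriv (v q) = 0"
proof -
  have eq: "(\<Sum>j=p..q. ext_deriv (v j)) + (\<Sum>j=p..q. codiff (v j)) = 0"
    using MT_D(3)[OF P] ext_deriv_sum[of "{p..q}" v, OF poly_formsD(3)[OF v]]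
      codiff_sum[of "{p..q}" v, OF poly_formsD(3)[OF v]] unfolding P_eq by simp
  have sum: "(\<Sum>j=p..q. ext_deriv (v j)) x vs + (\<Sum>j=p..q. codiff (v j)) x vs = 0" for x vs
    using fun_cong[OF fun_cong[OF eq], of x vs] by simp
  have D: "(\<Sum>j=p..q. ext_deriv (v j)) x vs = ext_deriv (v j) x vs"
    if "j \<in> {p..q}" "length vs = r + 2 * j + 1" for j x vs
    by (rule graded_sum_apply[where t = "\<lambda>n. n" and w = "\<lambda>j. ext_deriv (v j)",
          OF finite_atLeastAtMost inj_degrees(2) ext_deriv_graded[OF v] that])
  show "ext_deriv (v j) = - codiff (v (Suc j))" if j: "p \<le> j" "j < q" for j
  proof (intro ext)
    fix x vs
    have vj: "v j \<in> poly_forms (r + 2 * j) k" and vSj: "v (Suc j) \<in> poly_forms (r + 2 * Suc j) k"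
      using j by (auto intro!: v simp del: mult_Suc_right)
    show "ext_deriv (v j) x vs = (- codiff (v (Suc j))) x vs"
    proof (cases "length vs = r + 2 * j + 1")
      case True
      have "(\<Sum>j=p..q. codiff (v j)) x vs = codiff (v (Suc j)) x vs"
        by (rule graded_sum_apply[where t = Suc and w = "\<lambda>j. codiff (v j)",
              OF finite_atLeastAtMost inj_degrees(1) codiff_graded[OF v]])
          (use j True in auto)
      then show ?thesis
        using sum[of x vs] D[OF _ True] j by simp
    next
      case False
      then have "codiff (v (Suc j)) x vs = 0"
        by (intro codiff_graded[OF vSj]) simp
      then show ?thesis
        using ext_deriv_graded[OF vj False] by simp
    qed
  qed
  show "ext_deriv (v q) = 0" if "p \<le> q"
  proof (intro ext)
    fix x vs
    show "ext_deriv (v q) x vs = 0 x vs"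
    proof (cases "length vs = r + 2 * q + 1")
      case True
      have "(\<Sum>j=p..q. codiff (v j)) x vs = 0"
        unfolding sum_fun_apply by (intro sum.neutral ballI codiff_graded[OF v]) (use True in auto)
      then show ?thesis
        using sum[of x vs] D[OF _ True] that by simp
    next
      case False
      then show ?thesis
        using ext_deriv_graded[OF v False] that by simp
    qed
  qed
qed

text \<open>For a solution \<open>P\<close>, closedness forces \<open>codiff P = 0\<close>. Each
  operator sends the components to distinct degrees, so both equations hold componentwise.\<close>

lemma kernel_eq:
  "{P \<in> (MT r p q k :: 'm::finite dform set). ext_deriv P = 0} =
    sum_of_spaces {p..q} (\<lambda>j. Hodge (r + 2 * j) k)"
proof (intro subset_antisym subsetI)
  fix P :: "'m dform" assume "P \<in> {P \<in> MT r p q k. ext_deriv P = 0}"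
  then have P: "P \<in> MT r p q k" and dP: "ext_deriv P = 0" by auto
  obtain v where P_eq: "P = (\<Sum>j=p..q. v j)"
    and v: "\<And>j. j \<in> {p..q} \<Longrightarrow> v j \<in> poly_forms (r + 2 * j) k"
    using poly_forms_rpqE[OF MT_D(1)[OF P]] by metis
  have sum_d: "(\<Sum>j=p..q. ext_deriv (v j)) = 0"
    using dP ext_deriv_sum[of "{p..q}" v, OF poly_formsD(3)[OF v]] unfolding P_eq by simp
  have d: "ext_deriv (v j) = 0" if "j \<in> {p..q}" for j
    by (rule graded_sum_zero[where t = "\<lambda>n. n" and w = "\<lambda>j. ext_deriv (v j)",
          OF finite_atLeastAtMost inj_degrees(2) ext_deriv_graded[OF v] sum_d that])
  have sum_c: "(\<Sum>j=p..q. codiff (v j)) = 0"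
    using MT_D(3)[OF P] dP codiff_sum[of "{p..q}" v, OF poly_formsD(3)[OF v]] unfolding P_eq by simp
  have "codiff (v j) = 0" if "j \<in> {p..q}" for j
    by (rule graded_sum_zero[where t = Suc and w = "\<lambda>j. codiff (v j)",
          OF finite_atLeastAtMost inj_degrees(1) codiff_graded[OF v] sum_c that])
  with d v show "P \<in> sum_of_spaces {p..q} (\<lambda>j. Hodge (r + 2 * j) k)"
    unfolding sum_of_spaces_def P_eq Hodge_def by blast
next
  fix P :: "'m dform" assume "P \<in> sum_of_spaces {p..q} (\<lambda>j. Hodge (r + 2 * j) k)"
  then obtain v where P_eq: "P = (\<Sum>j=p..q. v j)"
    and v: "\<And>j. j \<in> {p..q} \<Longrightarrow> v j \<in> Hodge (r + 2 * j) k"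
    unfolding sum_of_spaces_def by blast
  have v': "v j \<in> poly_forms (r + 2 * j) k" "ext_deriv (v j) = 0" "codiff (v j) = 0"
    if "j \<in> {p..q}" for j
    using v[OF that] by (simp_all add: Hodge_def)
  have "ext_deriv P = 0" "codiff P = 0"
    unfolding P_eq using ext_deriv_sum[of "{p..q}" v, OF poly_formsD(3)[OF v'(1)]]
      codiff_sum[of "{p..q}" v, OF poly_formsD(3)[OF v'(1)]] v'(2,3) by simp_all
  moreover have "P \<in> poly_forms_rpq r p q k"
    unfolding P_eq poly_forms_rpq_def sum_of_spaces_def using v'(1) by blast
  ultimately show "P \<in> {P \<in> MT r p q k. ext_deriv P = 0}"
    by (simp add: MT_def)
qed

text \<open>Each \<open>ext_deriv (v j)\<close> with \<open>j < q\<close> is, by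
  \<open>MT_components\<close>, also minus a codifferential. It is therefore closed and
  coclosed.\<close>

lemma ext_deriv_MT:
  fixes P :: "'m::finite dform"
  assumes pq: "p \<le> q" and P: "P \<in> MT r p q k"
  shows "ext_deriv P \<in> sum_of_spaces {p..<q} (\<lambda>j. Hodge (r + 2 * j + 1) (k - 1))"
proof -
  obtain v where P_eq: "P = (\<Sum>j=p..q. v j)"
    and v: "\<And>j. j \<in> {p..q} \<Longrightarrow> v j \<in> poly_forms (r + 2 * j) k"
    using poly_forms_rpqE[OF MT_D(1)[OF P]] by metis
  note comp = MT_components[OF P P_eq v]
  have "ext_deriv P = (\<Sum>j=p..q. ext_deriv (v j))"
    unfolding P_eq by (rule ext_deriv_sum[OF poly_formsD(3)[OF v]])
  \<comment> \<open>The top component is closed and drops out, which leaves the index set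
    \<open>{p..<q}\<close>.\<close>
  also have "{p..q} = insert q {p..<q}"
    using pq by auto
  finally have "ext_deriv P = (\<Sum>j\<in>{p..<q}. ext_deriv (v j))"
    using comp(2)[OF _ pq] by simp
  moreover have "ext_deriv (v j) \<in> Hodge (r + 2 * j + 1) (k - 1)" if j: "j \<in> {p..<q}" for j
  proof -
    have vj: "v j \<in> poly_forms (r + 2 * j) k" and vSj: "v (Suc j) \<in> poly_forms (r + 2 * Suc j) k"
      using j by (auto intro!: v simp del: mult_Suc_right)
    \<comment> \<open>Negation is written as a scaling so that \<open>codiff_scaleR\<close> can
      carry the conclusion of \<open>codiff_codiff\<close> over to
      \<open>ext_deriv (v j)\<close>.\<close>
    have "codiff (v (Suc j)) = - 1 *\<^sub>R ext_deriv (v j)"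
      using comp(1)[of j] j by simp
    then have "codiff (- 1 *\<^sub>R ext_deriv (v j)) = 0"
      using codiff_codiff[OF poly_formsD(3,1)[OF vSj]] by simp
    then have "codiff (ext_deriv (v j)) = 0"
      unfolding codiff_scaleR[OF ext_deriv_poly_coeffs[OF poly_formsD(3)[OF vj]]] by simp
    then show ?thesis
      using ext_deriv_poly_forms[OF vj k] ext_deriv_ext_deriv[OF poly_formsD(3)[OF vj]]
      by (simp add: Hodge_def)
  qed
  ultimately show ?thesis
    unfolding sum_of_spaces_def by blast
qed

text \<open>For \<open>j < q\<close> the two pieces of \<open>splitting k (w j)\<close> lie in the
  components \<open>j\<close> and \<open>Suc j\<close>, both within \<open>{p..q}\<close>. The
  dimension bound gives \<open>r + 2 * j + 2 \<le> CARD('m)\<close>, as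
  \<open>splitting_Hodge\<close> requires.\<close>

lemma splitting_MT:
  fixes h :: "'m::finite dform"
  assumes m: "r + 2 * q \<le> CARD('m)"
    and h: "h \<in> sum_of_spaces {p..<q} (\<lambda>j. Hodge (r + 2 * j + 1) (k - 1))"
  shows "splitting k h \<in> MT r p q k" "ext_deriv (splitting k h) = h"
proof -
  obtain w where h_eq: "h = (\<Sum>j\<in>{p..<q}. w j)"
    and w: "\<And>j. j \<in> {p..<q} \<Longrightarrow> w j \<in> Hodge (r + 2 * j + 1) (k - 1)"
    using h unfolding sum_of_spaces_def by blast
  have S: "splitting k (w j) \<in> MT r p q k" "ext_deriv (splitting k (w j)) = w j" if j: "j \<in> {p..<q}" for j
  proof -
    have "w j \<in> Hodge (Suc (r + 2 * j)) (k - 1)" "r + 2 * j + 2 \<le> CARD('m)"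
      using w[OF j] j m by simp_all
    then obtain u v where uv: "splitting k (w j) = u + v"
      and u: "u \<in> poly_forms (r + 2 * j) k" "ext_deriv u = w j" "codiff u = 0"
      and v: "v \<in> poly_forms (r + 2 * j + 2) k" "ext_deriv v = 0" "codiff v = - w j"
      using splitting_Hodge[OF _ k] by metis
    have "u \<in> poly_forms_rpq r p q k"
      unfolding poly_forms_rpq_def
      by (rule sum_of_spaces_member[of _ _ j]) (use j u subspace_poly_forms in auto)
    moreover have "v \<in> poly_forms_rpq r p q k"
      unfolding poly_forms_rpq_def
      by (rule sum_of_spaces_member[of _ _ "Suc j"]) (use j v subspace_poly_forms in auto)
    ultimately have "u + v \<in> poly_forms_rpq r p q k"
      by (rule subspace_add[OF subspace_poly_forms_rpq])
    moreover note poly_formsD(3)[OF u(1)] poly_formsD(3)[OF v(1)]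
    ultimately show "splitting k (w j) \<in> MT r p q k" "ext_deriv (splitting k (w j)) = w j"
      by (simp_all add: uv MT_def ext_deriv_add codiff_add u v)
  qed
  show "splitting k h \<in> MT r p q k"
    unfolding h_eq splitting_sum by (rule subspace_sum[OF subspace_MT S(1)])
  show "ext_deriv (splitting k h) = h"
    unfolding h_eq splitting_sum
    using S(2) ext_deriv_sum[of "{p..<q}" "\<lambda>j. splitting k (w j)", OF MT_D(2)[OF S(1)]] by simp
qed

end

section \<open>The image and the equivariant isomorphism\<close>

lemma ext_deriv_image_MT:
  fixes r p q k :: nat
  assumes "p \<le> q" "r + 2 * q \<le> CARD('m::finite)" "1 \<le> k"
  shows "ext_deriv ` (MT r p q k :: 'm dform set) =
    sum_of_spaces {p..<q} (\<lambda>j. Hodge (r + 2 * j + 1) (k - 1))"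
proof (intro subset_antisym subsetI)
  fix h :: "'m dform"
  assume "h \<in> sum_of_spaces {p..<q} (\<lambda>j. Hodge (r + 2 * j + 1) (k - 1))"
  then show "h \<in> ext_deriv ` MT r p q k"
    using splitting_MT[OF assms(3,2)] by (intro rev_image_eqI[of "splitting k h"]) simp_all
qed (use ext_deriv_MT[OF assms(3,1)] in blast)

lemma splitting_ext_deriv:
  fixes a :: "'m::finite dform"
  assumes "p \<le> q" "r + 2 * q \<le> CARD('m)" "1 \<le> k" and a: "a \<in> MT r p q k"
  shows "splitting k (ext_deriv a) \<in> MT r p q k" "ext_deriv (splitting k (ext_deriv a)) = ext_deriv a"
  by (rule splitting_MT[OF assms(3,2) ext_deriv_MT[OF assms(3,1) a]])+

lemma O_submodule_MT: "O_submodule form_act (MT r p q k)"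
  by (simp add: O_submodule_def subspace_MT form_act_MT)

lemma O_submodule_kernel_image:
  fixes r p q k :: nat
  assumes "p \<le> q" "r + 2 * q \<le> CARD('m::finite)" "1 \<le> k"
  shows "O_submodule (\<lambda>g. map_prod (form_act g) (form_act g))
    ({P \<in> (MT r p q k :: 'm dform set). ext_deriv P = 0} \<times> ext_deriv ` MT r p q k)"
proof -
  let ?M = "MT r p q k :: 'm dform set"
  \<comment> \<open>The explicit descriptions of kernel and image as sums of Hodge spaces yield the
    subspace property.\<close>
  have "subspace {P \<in> ?M. ext_deriv P = 0}" "subspace (ext_deriv ` ?M)"
    unfolding kernel_eq[OF assms(3)] ext_deriv_image_MT[OF assms]
    by (intro subspace_sum_of_spaces subspace_Hodge)+
  moreover have act: "form_act g P \<in> ?M" "ext_deriv (form_act g P) = form_act g (ext_deriv P)"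
    if "orthogonal_transformation g" "P \<in> ?M" for g P
    using form_act_MT[OF that] ext_deriv_form_act[OF that(1) MT_D(2)[OF that(2)]] .
  moreover have "form_act g (ext_deriv P) \<in> ext_deriv ` ?M"
    if "orthogonal_transformation g" "P \<in> ?M" for g P
    unfolding act(2)[OF that, symmetric] by (rule imageI[OF act(1)[OF that]])
  ultimately show ?thesis
    unfolding O_submodule_def by (auto intro: subspace_Times simp: form_act_zero)
qed

lemma bij_betw_MT_kernel_image:
  fixes r p q k :: nat
  assumes "p \<le> q" "r + 2 * q \<le> CARD('m::finite)" "1 \<le> k"
  shows "bij_betw (\<lambda>P. (P - splitting k (ext_deriv P), ext_deriv P)) (MT r p q k :: 'm dform set)
    ({P \<in> MT r p q k. ext_deriv P = 0} \<times> ext_deriv ` MT r p q k)"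
\<comment> \<open>The inverse recombines the two parts: if \<open>a\<close> is closed and
  \<open>b\<close> lies in the image, then \<open>a + splitting k b\<close> has differential
  \<open>b\<close>, and subtracting \<open>splitting k b\<close> returns \<open>a\<close>.\<close>
proof (rule bij_betw_byWitness[where f' = "\<lambda>(a, b). a + splitting k b"])
  let ?M = "MT r p q k :: 'm dform set"
  note S = splitting_ext_deriv[OF assms]
  have d_diff: "ext_deriv (a - b) = ext_deriv a - ext_deriv b" if "a \<in> ?M" "b \<in> ?M" for a b
    using ext_deriv_add[OF MT_D(2)[OF subspace_diff[OF subspace_MT that]] MT_D(2)[OF that(2)]]
    by (simp add: eq_diff_eq)
  have d_add: "ext_deriv (a + b) = ext_deriv a + ext_deriv b" if "a \<in> ?M" "b \<in> ?M" for a b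
    by (rule ext_deriv_add[OF MT_D(2)[OF that(1)] MT_D(2)[OF that(2)]])
  show "(\<lambda>P. (P - splitting k (ext_deriv P), ext_deriv P)) ` ?M \<subseteq>
      {P \<in> ?M. ext_deriv P = 0} \<times> ext_deriv ` ?M"
    using S by (auto simp: d_diff subspace_diff[OF subspace_MT])
  show "(\<lambda>(a, b). a + splitting k b) ` ({P \<in> ?M. ext_deriv P = 0} \<times> ext_deriv ` ?M) \<subseteq> ?M"
    using S(1) by (auto intro: subspace_add[OF subspace_MT])
  show "\<forall>ab\<in>{P \<in> ?M. ext_deriv P = 0} \<times> ext_deriv ` ?M.
      (\<lambda>P. (P - splitting k (ext_deriv P), ext_deriv P)) (case ab of (a, b) \<Rightarrow> a + splitting k b) = ab"
    using S by (auto simp: d_add)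
qed simp

lemma O_isomorphic_MT_kernel_image:
  fixes r p q k :: nat
  assumes "p \<le> q" "r + 2 * q \<le> CARD('m::finite)" "1 \<le> k"
  shows "O_isomorphic form_act (MT r p q k :: 'm dform set) (\<lambda>g. map_prod (form_act g) (form_act g))
    ({P \<in> MT r p q k. ext_deriv P = 0} \<times> ext_deriv ` MT r p q k)"
  unfolding O_isomorphic_def
proof (intro conjI exI[of _ "\<lambda>P. (P - splitting k (ext_deriv P), ext_deriv P)"] ballI allI impI
    O_submodule_MT O_submodule_kernel_image[OF assms] bij_betw_MT_kernel_image[OF assms])
  fix a b :: "'m dform" assume "a \<in> MT r p q k" "b \<in> MT r p q k"
  from this[THEN MT_D(2)]
  show "(a + b - splitting k (ext_deriv (a + b)), ext_deriv (a + b)) =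
      (a - splitting k (ext_deriv a), ext_deriv a) + (b - splitting k (ext_deriv b), ext_deriv b)"
    by (simp add: ext_deriv_add splitting_add)
next
  fix c and a :: "'m dform" assume "a \<in> MT r p q k"
  from this[THEN MT_D(2)]
  show "(c *\<^sub>R a - splitting k (ext_deriv (c *\<^sub>R a)), ext_deriv (c *\<^sub>R a)) =
      c *\<^sub>R (a - splitting k (ext_deriv a), ext_deriv a)"
    by (simp add: ext_deriv_scaleR splitting_scaleR scaleR_diff_right)
next
  fix g :: "real^'m \<Rightarrow> real^'m" and a :: "'m dform"
  assume "orthogonal_transformation g" "a \<in> MT r p q k"
  from this(1) this(2)[THEN MT_D(2)]
  show "(form_act g a - splitting k (ext_deriv (form_act g a)), ext_deriv (form_act g a)) =
      map_prod (form_act g) (form_act g) (a - splitting k (ext_deriv a), ext_deriv a)"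
    by (simp add: ext_deriv_form_act splitting_form_act form_act_diff)
qed

theorem theorem1:
  fixes r p q k :: nat
  assumes "p \<le> q" and "r + 2 * q \<le> CARD('m::finite)" and "1 \<le> k"
  shows
    "is_direct_sum {P \<in> (MT r p q k :: 'm dform set). ext_deriv P = 0}
       {p..q} (\<lambda>j. Hodge (r + 2 * j) k) \<and>
     is_direct_sum (ext_deriv ` (MT r p q k :: 'm dform set))
       {p..<q} (\<lambda>j. Hodge (r + 2 * j + 1) (k - 1)) \<and>
     O_isomorphic form_act (MT r p q k :: 'm dform set)
       (\<lambda>g. map_prod (form_act g) (form_act g))
       ({P \<in> MT r p q k. ext_deriv P = 0} \<times> ext_deriv ` MT r p q k)"
  by (intro conjI is_direct_sum_Hodge inj_degrees finite_atLeastAtMost finite_atLeastLessThan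
      kernel_eq[OF assms(3)] ext_deriv_image_MT[OF assms] O_isomorphic_MT_kernel_image[OF assms])

end
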